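(* Let $\mathcal{T}=\{R_{\alpha_1}P_{i_1}+t_1,\ R_{\alpha_2}P_{i_2}+t_2,\ \ldots\}$ be a primitive substitution tiling of $\mathbb{R}^2$ of statistical circular symmetry, with prototiles $P_1,\ldots,P_m$. Choose points $x_i\in P_i$ for $1\le i\le m$, and define $\Lambda=\{R_{\alpha_1}x_{i_1}+t_1,\ R_{\alpha_2}x_{i_2}+t_2,\ \ldots\}$. Then the diffraction of $\Lambda$ is circular symmetric, i.e. the diffraction measure $\widehat{\gamma_\Lambda}$ satisfies $R.\widehat{\gamma_\Lambda}=\widehat{\gamma_\Lambda}$ for every rotation $R$ of $\mathbb{R}^2$ about the origin.
   Context: Prototiles and tiles. The prototiles $P_1,\ldots,P_m$ are compact subsets of $\mathbb{R}^2$, each equal to the closure of its interior. A tile is a set of the form $R_\alpha P_i+t$, where $R_\alpha$ is the rotation about the origin through the angle $\alpha\in[0,2\pi[$ and $t\in\mathbb{R}^2$; its orientation is $\phi(R_\alpha P_i+t)=\alpha$. Two prototiles may be congruent as sets; in that case they carry distinguishing decorations, every tile carries the decoration of its prototile, and "congruent" always means with respect to decorations. A tiling is a collection of tiles covering $\mathbb{R}^2$ such that every $x\in\mathbb{R}^2$ lies in the interior of at most one tile. Substitutions. A substitution $\sigma$ with inflation factor $\lambda>1$ maps each prototile $P_i$ to a finite non-overlapping collection $\sigma(P_i)$ of tiles, each congruent to some prototile, and is assumed selfsimilar: $\lambda P_i=\bigcup_{T\in\sigma(P_i)}T$ for $1\le i\le m$. It extends to tiles by $\sigma(RP_i+t)=R\,\sigma(P_i)+\lambda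 t$ ($R$ a rotation, $t\in\mathbb{R}^2$) and to finite or infinite collections of tiles by $\sigma(\{T_1,T_2,\ldots\})=\sigma(T_1)\cup\sigma(T_2)\cup\cdots$. The collections $\sigma^k(P_i)$ are the $k$-th order supertiles. The substitution matrix $M_\sigma$ is the $m\times m$ matrix with $(M_\sigma)_{ij}=\#\{T\in\sigma(P_j): T=RP_i+t \text{ for some rotation } R \text{ and } t\in\mathbb{R}^2\}$; $\sigma$ is primitive if $M_\sigma^k$ is strictly positive for some $k\ge1$. A tiling $\mathcal{T}$ is a substitution tiling with substitution $\sigma$ if for every finite subset $\mathcal{F}\subset\mathcal{T}$ there are $i,k$ such that a congruent copy of $\mathcal{F}$ is contained in the supertile $\sigma^k(P_i)$. It is a primitive substitution tiling if $\sigma$ is primitive. Statistical circular symmetry. Let $\mathcal{T}=\{T_1,T_2,\ldots\}$ be a primitive substitution tiling with substitution $\sigma$, numbered such that for all $n\ge1$ there is some $\ell\ge n$ for which the patch $\{T_1,\ldots,T_\ell\}$ is congruent to some supertile $\sigma^k(P_i)$, with $P_i$ a prototile and $k\ge1$. The tiling $\mathcal{T}$ has (is of) statistical circular symmetry if for all $0\le x<y<2\pi$ $$\lim_{n\to\infty}\frac1n\sum_{j=1}^n 1_{[x,y]}(\phi(T_j))=\frac{y-x}{2\pi}.$$ Autocorrelation and diffraction. With $B_r$ the closed ball of radius $r$ around the origin and $\delta_z$ the Dirac measure at $z$, the autocorrelation of $\Lambda$ is $$\gamma_\Lambda=\lim_{r\to\infty}\frac{1}{\mathrm{vol}(B_r)}\sum_{x,y\in\Lambda\cap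 B_r}\delta_{x-y},$$ if the limit exists, the limit being in the vague topology; if the limit does not exist, there is a subsequence converging to an autocorrelation. It is a translation bounded, positive definite measure. Its Fourier transform $\widehat{\gamma_\Lambda}$ (in the sense of tempered distributions) is a measure, called the diffraction measure (diffraction) of $\Lambda$. Rotated measures. For a rotation $R$ and a measure $\mu$, $R.\mu$ is defined by $R.\mu(A)=\mu(R^{-1}A)$ for all measurable $A$; $\mu$ is of circular symmetry (circular symmetric) if $R.\mu=\mu$ for all rotations $R$. *)

theory Defs
  imports "HOL-Analysis.Analysis"
begin

section \<open>Prototiles, tiles and tilings of the plane\<close>

text \<open>
  The plane is the type \<^typ>\<open>complex\<close>; the rotation about the origin through the angle
  \<open>\<alpha>\<close> is multiplication by \<open>cis \<alpha>\<close>, so rotations are identified with the complex numbers of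
  modulus 1. The prototiles are a family \<open>P\<close> indexed by a finite type \<open>'i\<close>, with \<open>m = CARD('i)\<close>.

  \<open>Tile i u t\<close> stands for the tile \<open>u P\<^sub>i + t\<close> decorated with its prototile and placement.
  Carrying the placement as data makes the orientation, the substituted tile and the control point
  of a tile well defined even when a prototile has rotational symmetries, or when two
  prototiles are congruent as sets.
\<close>

datatype 'i tile = Tile (proto: 'i) (rot: complex) (shift: complex)

definition tiles :: "'i tile set" where
  "tiles = {T. cmod (rot T) = 1}"

definition orientation :: "'i tile \<Rightarrow> real" where
  "orientation T = Arg2pi (rot T)"

definition place :: "'i tile \<Rightarrow> complex \<Rightarrow> complex" where
  "place T z = rot T * z + shift T"

definition support :: "('i \<Rightarrow> complex set) \<Rightarrow> 'i tile \<Rightarrow> complex set" where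
  "support P T = place T ` P (proto T)"

definition prototiles :: "('i \<Rightarrow> complex set) \<Rightarrow> bool" where
  "prototiles P \<longleftrightarrow> (\<forall>i. compact (P i) \<and> closure (interior (P i)) = P i)"

definition non_overlapping :: "('i \<Rightarrow> complex set) \<Rightarrow> 'i tile set \<Rightarrow> bool" where
  "non_overlapping P F \<longleftrightarrow>
     pairwise (\<lambda>S T. disjnt (interior (support P S)) (interior (support P T))) F"

definition tiling :: "('i \<Rightarrow> complex set) \<Rightarrow> 'i tile set \<Rightarrow> bool" where
  "tiling P F \<longleftrightarrow> F \<subseteq> tiles \<and> (\<Union>T\<in>F. support P T) = UNIV \<and> non_overlapping P F"

text \<open>The tile \<open>u T + v\<close>.\<close>

definition move :: "complex \<Rightarrow> complex \<Rightarrow> 'i tile \<Rightarrow> 'i tile" where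
  "move u v T = Tile (proto T) (u * rot T) (u * shift T + v)"

text \<open>
  Congruence respects decorations, and tiles are obtained from prototiles by rotations and
  translations only; hence the congruences are the orientation preserving isometries.
\<close>

definition congruent :: "'i tile set \<Rightarrow> 'i tile set \<Rightarrow> bool" where
  "congruent F G \<longleftrightarrow> (\<exists>u v. cmod u = 1 \<and> G = move u v ` F)"


section \<open>Substitutions\<close>

definition substitution ::
    "('i \<Rightarrow> complex set) \<Rightarrow> real \<Rightarrow> ('i \<Rightarrow> 'i tile set) \<Rightarrow> bool" where
  "substitution P l \<sigma> \<longleftrightarrow> l > 1 \<and>
     (\<forall>i. finite (\<sigma> i) \<and> \<sigma> i \<subseteq> tiles \<and> non_overlapping P (\<sigma> i) \<and>
          (\<lambda>z. l *\<^sub>R z) ` P i = (\<Union>T\<in>\<sigma> i. support P T))"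

text \<open>\<open>\<sigma>(u P\<^sub>i + t) = u \<sigma>(P\<^sub>i) + l t\<close>\<close>

definition subst_tile :: "real \<Rightarrow> ('i \<Rightarrow> 'i tile set) \<Rightarrow> 'i tile \<Rightarrow> 'i tile set" where
  "subst_tile l \<sigma> T = move (rot T) (l *\<^sub>R shift T) ` \<sigma> (proto T)"

definition subst :: "real \<Rightarrow> ('i \<Rightarrow> 'i tile set) \<Rightarrow> 'i tile set \<Rightarrow> 'i tile set" where
  "subst l \<sigma> F = (\<Union>T\<in>F. subst_tile l \<sigma> T)"

definition supertile :: "real \<Rightarrow> ('i \<Rightarrow> 'i tile set) \<Rightarrow> nat \<Rightarrow> 'i \<Rightarrow> 'i tile set" where
  "supertile l \<sigma> k i = (subst l \<sigma> ^^ k) {Tile i 1 0}"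

definition subst_matrix :: "('i \<Rightarrow> 'i tile set) \<Rightarrow> nat ^ 'i::finite ^ 'i" where
  "subst_matrix \<sigma> = (\<chi> i j. card {T \<in> \<sigma> j. proto T = i})"

definition primitive :: "('i::finite \<Rightarrow> 'i tile set) \<Rightarrow> bool" where
  "primitive \<sigma> \<longleftrightarrow>
     (\<exists>k\<ge>1. \<forall>i j. (((**) (subst_matrix \<sigma>) ^^ k) (mat 1)) $ i $ j > 0)"

definition substitution_tiling ::
    "('i \<Rightarrow> complex set) \<Rightarrow> real \<Rightarrow> ('i \<Rightarrow> 'i tile set) \<Rightarrow> 'i tile set \<Rightarrow> bool" where
  "substitution_tiling P l \<sigma> \<T> \<longleftrightarrow> substitution P l \<sigma> \<and> tiling P \<T> \<and>
     (\<forall>F\<subseteq>\<T>. finite F \<longrightarrow> (\<exists>i k G. congruent F G \<and> G \<subseteq> supertile l \<sigma> k i))"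

definition primitive_substitution_tiling ::
    "('i::finite \<Rightarrow> complex set) \<Rightarrow> real \<Rightarrow> ('i \<Rightarrow> 'i tile set) \<Rightarrow> 'i tile set \<Rightarrow> bool" where
  "primitive_substitution_tiling P l \<sigma> \<T> \<longleftrightarrow> substitution_tiling P l \<sigma> \<T> \<and> primitive \<sigma>"


section \<open>Statistical circular symmetry\<close>

text \<open>The tiling is \<open>range T\<close>. It is numbered from 0: \<open>T j\<close> is the tile \<open>T\<^bsub>j+1\<^esub>\<close>.\<close>

definition supertile_numbering :: "real \<Rightarrow> ('i \<Rightarrow> 'i tile set) \<Rightarrow> (nat \<Rightarrow> 'i tile) \<Rightarrow> bool" where
  "supertile_numbering l \<sigma> T \<longleftrightarrow> inj T \<and>
     (\<forall>n\<ge>1. \<exists>L\<ge>n. \<exists>k\<ge>1. \<exists>i. congruent (T ` {..<L}) (supertile l \<sigma> k i))"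

definition statistical_circular_symmetry ::
    "('i::finite \<Rightarrow> complex set) \<Rightarrow> real \<Rightarrow> ('i \<Rightarrow> 'i tile set) \<Rightarrow> (nat \<Rightarrow> 'i tile) \<Rightarrow> bool" where
  "statistical_circular_symmetry P l \<sigma> T \<longleftrightarrow>
     primitive_substitution_tiling P l \<sigma> (range T) \<and> supertile_numbering l \<sigma> T \<and>
     (\<forall>x y. 0 \<le> x \<and> x < y \<and> y < 2 * pi \<longrightarrow>
        (\<lambda>n. (1 / real n) * (\<Sum>j<n. indicator {x..y} (orientation (T j))))
          \<longlonglongrightarrow> (y - x) / (2 * pi))"


section \<open>Autocorrelation and diffraction\<close>

definition radon_measure :: "'a::euclidean_space measure \<Rightarrow> bool" where
  "radon_measure \<mu> \<longleftrightarrow> sets \<mu> = sets borel \<and> (\<forall>K. compact K \<longrightarrow> emeasure \<mu> K < \<infinity>)"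

definition vague_limit ::
    "(nat \<Rightarrow> 'a::euclidean_space measure) \<Rightarrow> 'a measure \<Rightarrow> bool" where
  "vague_limit M \<mu> \<longleftrightarrow>
     (\<forall>f :: 'a \<Rightarrow> real. continuous_on UNIV f \<and> compact (closure {x. f x \<noteq> 0}) \<longrightarrow>
        (\<lambda>n. \<integral>x. f x \<partial>M n) \<longlonglongrightarrow> (\<integral>x. f x \<partial>\<mu>))"

text \<open>\<open>(1 / vol B\<^sub>r) \<Sum>\<^bsub>x, y \<in> \<Lambda> \<inter> B\<^sub>r\<^esub> \<delta>\<^bsub>x - y\<^esub>\<close>\<close>

definition finite_autocorrelation :: "'a::euclidean_space set \<Rightarrow> real \<Rightarrow> 'a measure" where
  "finite_autocorrelation \<Lambda> r =
     scale_measure (ennreal (1 / measure lborel (cball 0 r :: 'a set)))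
       (distr (count_space ((\<Lambda> \<inter> cball 0 r) \<times> (\<Lambda> \<inter> cball 0 r))) borel (\<lambda>(x, y). x - y))"

text \<open>
  The autocorrelations of \<open>\<Lambda>\<close> are the limits along arbitrary sequences of radii tending to
  infinity. If the limit for \<open>r \<rightarrow> \<infinity>\<close> exists, it is the only autocorrelation in this sense.
\<close>

definition autocorrelation :: "'a::euclidean_space set \<Rightarrow> 'a measure \<Rightarrow> bool" where
  "autocorrelation \<Lambda> \<gamma> \<longleftrightarrow> radon_measure \<gamma> \<and>
     (\<exists>r. filterlim r at_top sequentially \<and>
          vague_limit (\<lambda>n. finite_autocorrelation \<Lambda> (r n)) \<gamma>)"

primrec iterated_partial ::
    "'a::euclidean_space list \<Rightarrow> ('a \<Rightarrow> complex) \<Rightarrow> ('a \<Rightarrow> complex)" where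
  "iterated_partial [] f = f"
| "iterated_partial (b # bs) f = (\<lambda>x. frechet_derivative (iterated_partial bs f) (at x) b)"

definition schwartz :: "('a::euclidean_space \<Rightarrow> complex) \<Rightarrow> bool" where
  "schwartz f \<longleftrightarrow>
     (\<forall>bs. set bs \<subseteq> Basis \<longrightarrow>
        (\<forall>x. iterated_partial bs f differentiable (at x)) \<and>
        (\<forall>N::nat. bounded (range (\<lambda>x. (1 + norm x) ^ N *\<^sub>R iterated_partial bs f x))))"

definition fourier :: "('a::euclidean_space \<Rightarrow> complex) \<Rightarrow> 'a \<Rightarrow> complex" where
  "fourier f k = (\<integral>x. cis (- 2 * pi * (k \<bullet> x)) * f x \<partial>lborel)"

text \<open>
  \<open>\<mu>\<close> is the Fourier transform of \<open>\<gamma>\<close> as a tempered distribution. The integrability conditions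
  say that both measures define tempered distributions; without them the Bochner
  integrals could take the default value 0.
\<close>

definition fourier_measure :: "'a::euclidean_space measure \<Rightarrow> 'a measure \<Rightarrow> bool" where
  "fourier_measure \<gamma> \<mu> \<longleftrightarrow> radon_measure \<gamma> \<and> radon_measure \<mu> \<and>
     (\<forall>f. schwartz f \<longrightarrow> integrable \<gamma> f \<and> integrable \<mu> f \<and>
          (\<integral>x. f x \<partial>\<mu>) = (\<integral>x. fourier f x \<partial>\<gamma>))"

definition diffraction :: "'a::euclidean_space set \<Rightarrow> 'a measure \<Rightarrow> bool" where
  "diffraction \<Lambda> \<mu> \<longleftrightarrow> (\<exists>\<gamma>. autocorrelation \<Lambda> \<gamma> \<and> fourier_measure \<gamma> \<mu>)"

text \<open>\<open>(R.\<mu>)(A) = \<mu>(R\<^sup>-\<^sup>1 A)\<close>, where \<open>R\<close> is multiplication by \<open>u\<close>.\<close>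

definition rotated_measure :: "complex \<Rightarrow> complex measure \<Rightarrow> complex measure" where
  "rotated_measure u \<mu> = distr \<mu> borel (\<lambda>z. u * z)"

definition circular_symmetric :: "complex measure \<Rightarrow> bool" where
  "circular_symmetric \<mu> \<longleftrightarrow> (\<forall>u. cmod u = 1 \<longrightarrow> rotated_measure u \<mu> = \<mu>)"

end

theory Submission
  imports Defs
begin

text \<open>
  If the autocorrelation \<open>\<gamma>\<close> is invariant under rotations, so is its Fourier transform. By
  Stone-Weierstrass, \<open>\<gamma>\<close> is invariant as soon as it annihilates every continuous \<open>F\<close> of compact
  support with \<open>F (u z) = u\<^sup>m F z\<close> for all \<open>\<bar>u\<bar> = 1\<close>, where \<open>m > 0\<close>.

  For such an \<open>F\<close> let \<open>s\<^sub>k(i)\<close> be the sum of \<open>F (x - y)\<close> over the pairs of control points of the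
  \<open>k\<close>-th order supertile of type \<open>i\<close>. Up to pairs near the boundaries of the \<open>k\<close>-th order supertiles,
  which are negligible because the prototiles turn out to have boundaries of measure zero,
  \<open>s\<^bsub>k+n\<^esub>(j)\<close> is the sum of \<open>u\<^sub>T\<^sup>m s\<^sub>k(i\<^sub>T)\<close> over the tiles \<open>T\<close> of the \<open>n\<close>-th order supertile of type
  \<open>j\<close>, where \<open>u\<^sub>T\<close> is the rotation and \<open>i\<^sub>T\<close> the type of \<open>T\<close>. Unless two tiles of equal type in some
  supertile differ in \<open>u\<^sub>T\<^sup>m\<close>, the tiling has only finitely many orientations, which
  statistical circular symmetry excludes. By primitivity such a pair occurs in all supertiles of
  some order \<open>n\<close>; the resulting cancellation makes the recursion, relative to areas, a strict
  contraction. Hence \<open>s\<^sub>k\<close> is of smaller order than the area, and so are the pair sums over large balls.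
\<close>

section \<open>Rotation invariance of Lebesgue measure\<close>

text \<open>An autocorrelation is a limit along some sequence of radii, and different sequences may
  give different limits. Working with one angular mode at a time avoids any comparison of limits:
  its pair sums over balls are shown to be o(r^2) for r \<rightarrow> \<infinity>, which settles
  every sequence at once.

  Self-similarity speaks of supertiles, the autocorrelation of balls. A ball is therefore filled, up
  to a collar, by supertiles of a fixed order k. Letting r grow removes the collar; choosing k large
  beforehand makes both the mode sums and the error from neighbouring supertiles small relative to
  area.

  Areas of prototile interiors are the weights in all estimates. They play the part of a left
  Perron-Frobenius eigenvector of the substitution matrix with eigenvalue l^2, so the plain triangle
  inequality already yields a recursion with factor at most 1, and one cancelling pair per supertile
  pushes the factor below 1.\<close>

text \<open>The library has invariance under orthogonal maps for \<open>real ^ 'n\<close> only, hence the detour over \<open>real ^ 2\<close>.\<close>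

lemma lborel_distr_rotation:
  assumes u: "cmod u = 1"
  shows "distr lborel borel ((*) u) = (lborel :: complex measure)"
proof -
  define \<phi> :: "real^2 \<Rightarrow> complex" where "\<phi> v = Complex (v$1) (v$2)" for v
  define \<psi> :: "complex \<Rightarrow> real^2" where "\<psi> z = (\<chi> i. if i = 1 then Re z else Im z)" for z
  have \<phi>\<psi>: "\<phi> (\<psi> z) = z" for z by (simp add: \<phi>_def \<psi>_def)
  have \<psi>\<phi>: "\<psi> (\<phi> v) = v" for v by (simp add: \<phi>_def \<psi>_def vec_eq_iff forall_2)
  have n\<psi>: "norm (\<psi> z) = cmod z" for z
    by (simp add: \<psi>_def norm_vec_def L2_set_def sum_2 cmod_def)
  have n\<phi>: "cmod (\<phi> z) = norm z" for z
    using n\<psi>[of "\<phi> z"] by (simp add: \<psi>\<phi>)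
  have lin\<phi>: "linear \<phi>" by (rule linearI) (simp_all add: \<phi>_def complex_eq_iff)
  have lin\<psi>: "linear \<psi>" by (rule linearI) (simp_all add: \<psi>_def vec_eq_iff)
  have m\<phi>[measurable]: "\<phi> \<in> borel_measurable borel"
    using lin\<phi> by (simp add: borel_measurable_continuous_onI linear_continuous_on linear_conv_bounded_linear)
  have vbox: "\<phi> -` box a b = box (\<psi> a) (\<psi> b)" for a b
    by (auto simp: \<phi>_def \<psi>_def in_box_complex_iff mem_box_cart forall_2)
  have prodeq: "(\<Prod>i\<in>Basis. (\<psi> b - \<psi> a) \<bullet> i) = (\<Prod>i\<in>Basis. (b - a) \<bullet> i)" for a b
  proof -
    have B: "(Basis :: (real^2) set) = {axis 1 1, axis 2 1}"
      by (auto simp: Basis_vec_def) (metis exhaust_2)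
    show ?thesis unfolding B Basis_complex_def
      by (simp add: \<psi>_def axis_eq_axis inner_axis complex_eq_iff)
  qed
  have distr\<phi>: "distr lborel borel \<phi> = lborel"
  proof (rule sym, rule lborel_eqI)
    fix a b :: complex assume le: "\<And>i. i \<in> Basis \<Longrightarrow> a \<bullet> i \<le> b \<bullet> i"
    have "\<psi> a \<bullet> i \<le> \<psi> b \<bullet> i" if "i \<in> Basis" for i
      using le[of 1] le[of \<i>] that
      by (auto simp: Basis_vec_def \<psi>_def inner_axis Basis_complex_def)
    then show "emeasure (distr lborel borel \<phi>) (box a b) = ennreal (\<Prod>i\<in>Basis. (b - a) \<bullet> i)"
      by (subst emeasure_distr) (auto simp: vbox prodeq emeasure_lborel_box)
  qed simp
  \<comment> \<open>The inverse rotation carried over to \<open>real^2\<close>: the preimage of a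
    box under multiplication by \<open>u\<close> becomes a \<open>g\<close>-image, to which
    invariance under orthogonal maps applies.\<close>
  define g where "g v = \<psi> (cnj u * \<phi> v)" for v
  have uu: "u * cnj u = 1" using complex_norm_square[of u] u by simp
  have og: "orthogonal_transformation g"
    unfolding orthogonal_transformation g_def
  proof
    have "linear (\<psi> \<circ> ((*) (cnj u) \<circ> \<phi>))"
      by (intro linear_compose lin\<phi> lin\<psi> linear_times)
    then show "linear (\<lambda>v. \<psi> (cnj u * \<phi> v))" by (simp add: o_def)
  qed (simp add: n\<psi> n\<phi> norm_mult u)
  show ?thesis
  proof (rule sym, rule lborel_eqI)
    fix a b :: complex assume le: "\<And>i. i \<in> Basis \<Longrightarrow> a \<bullet> i \<le> b \<bullet> i"
    let ?S = "box (\<psi> a) (\<psi> b)"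
    have leb: "\<psi> a \<bullet> i \<le> \<psi> b \<bullet> i" if "i \<in> Basis" for i
      using le[of 1] le[of \<i>] that
      by (auto simp: Basis_vec_def \<psi>_def inner_axis Basis_complex_def)
    have mu: "(*) u \<in> borel_measurable borel"
      by (intro borel_measurable_continuous_onI continuous_intros)
    have pre: "\<phi> -` ((*) u -` box a b) = g ` ?S"
    proof -
      have "v \<in> g ` ?S" if "u * \<phi> v \<in> box a b" for v
      proof -
        have "g (\<psi> (u * \<phi> v)) = v"
          using uu by (simp add: g_def \<phi>\<psi> \<psi>\<phi> mult.assoc[symmetric] mult.commute[of "cnj u"])
        moreover have "\<psi> (u * \<phi> v) \<in> ?S" unfolding vbox[symmetric] using that by (simp add: \<phi>\<psi>)
        ultimately show ?thesis by (metis imageI)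
      qed
      moreover have "u * \<phi> (g v) \<in> box a b" if "v \<in> ?S" for v
        using that uu unfolding vbox[symmetric] by (simp add: g_def \<phi>\<psi> mult.assoc[symmetric])
      ultimately show ?thesis by auto
    qed
    have bm: "(*) u -` box a b \<in> sets borel"
      using measurable_sets[OF mu, of "box a b"] by simp
    have "emeasure (distr lborel borel ((*) u)) (box a b) = emeasure lborel ((*) u -` box a b)"
      using mu by (subst emeasure_distr) auto
    also have "\<dots> = emeasure (distr lborel borel \<phi>) ((*) u -` box a b)" by (simp add: distr\<phi>)
    also have "\<dots> = emeasure lborel (g ` ?S)"
      using bm by (subst emeasure_distr) (auto simp: pre)
    also have "\<dots> = emeasure lebesgue (g ` ?S)"
    proof -
      have "g ` ?S \<in> sets borel" unfolding pre[symmetric]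
        using measurable_sets[OF m\<phi> bm] by simp
      then show ?thesis by simp
    qed
    also have "\<dots> = ennreal (measure lebesgue (g ` ?S))"
      by (intro emeasure_eq_measure2 measurable_orthogonal_image[OF og] lmeasurable_box)
    also have "\<dots> = ennreal (measure lebesgue ?S)"
      using measure_orthogonal_image[OF og, of ?S] by simp
    also have "\<dots> = ennreal (\<Prod>i\<in>Basis. (\<psi> b - \<psi> a) \<bullet> i)"
      using leb by (simp add: measure_lborel_box_eq)
    finally show "emeasure (distr lborel borel ((*) u)) (box a b) = ennreal (\<Prod>i\<in>Basis. (b - a) \<bullet> i)"
      by (simp add: prodeq)
  qed simp
qed

section \<open>Radon measures and smooth bump functions\<close>

text \<open>The classical flat function exp(-c/t), together with the negative powers of t that its
  derivatives produce. The parameter \<open>c\<close> controls sharpness: for \<open>n = 0\<close>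
  and c \<rightarrow> 0 the values at t > 0 tend to 1.\<close>

definition flat :: "real \<Rightarrow> nat \<Rightarrow> real \<Rightarrow> real" where
  "flat c n t = (if t > 0 then exp (- c / t) / t ^ n else 0)"

lemma flat_tendsto_0:
  assumes "c > 0"
  shows "(flat c n \<longlongrightarrow> 0) (at 0)"
proof -
  have "filterlim (\<lambda>t. c / t) at_top (at_right (0::real))"
    using assms filterlim_tendsto_pos_mult_at_top[OF tendsto_const _ filterlim_inverse_at_top_right]
    by (simp add: divide_inverse)
  from filterlim_compose[OF tendsto_power_div_exp_0[of n] this]
  have "((\<lambda>t. (c / t) ^ n / exp (c / t)) \<longlongrightarrow> 0) (at_right 0)" .
  then have "((\<lambda>t. (1 / c ^ n) * ((c / t) ^ n / exp (c / t))) \<longlongrightarrow> 1 / c ^ n * 0) (at_right 0)"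
    by (rule tendsto_mult_left)
  moreover have "eventually (\<lambda>t. (1 / c ^ n) * ((c / t) ^ n / exp (c / t)) = flat c n t) (at_right 0)"
    using assms unfolding eventually_at_right_field
    by (intro exI[of _ 1]) (auto simp: flat_def power_divide exp_minus field_simps)
  ultimately have "(flat c n \<longlongrightarrow> 0) (at_right 0)"
    by (simp add: filterlim_cong tendsto_cong)
  moreover have "(flat c n \<longlongrightarrow> 0) (at_left 0)"
    by (rule tendsto_eventually) (auto simp: flat_def eventually_at_left_field intro!: exI[of _ "-1"])
  ultimately show ?thesis by (simp add: filterlim_split_at)
qed

text \<open>The family is closed under differentiation up to linear combinations, and both sides
  vanish for negative t, so one formula serves everywhere.\<close>

lemma flat_has_derivative:
  assumes "c > 0"
  shows "(flat c n has_real_derivative c * flat c (n + 2) t - n * flat c (n + 1) t) (at t)"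
proof -
  consider "t > 0" | "t < 0" | "t = 0" by linarith
  then show ?thesis
  proof cases
    case 1
    have "((\<lambda>t. exp (- c / t) / t ^ n) has_real_derivative
        c * flat c (n + 2) t - n * flat c (n + 1) t) (at t)"
    proof -
      have "((\<lambda>t. exp (- c / t) / t ^ n) has_real_derivative
          (c / t\<^sup>2 * exp (- c / t) * t ^ n - exp (- c / t) * (real n * t ^ (n - 1))) / (t ^ n * t ^ n)) (at t)"
        using 1 by (auto intro!: derivative_eq_intros simp: power2_eq_square)
      moreover have "(c / t\<^sup>2 * exp (- c / t) * t ^ n - exp (- c / t) * (real n * t ^ (n - 1))) / (t ^ n * t ^ n)
          = c * flat c (n + 2) t - n * flat c (n + 1) t"
        using 1 by (cases n) (simp_all add: flat_def divide_simps, simp_all add: algebra_simps power2_eq_square)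
      ultimately show ?thesis by simp
    qed
    then show ?thesis
      by (rule has_field_derivative_transform_within_open[where S="{0<..}"])
         (use 1 in \<open>auto simp: flat_def\<close>)
  next
    case 2
    have "((\<lambda>t. 0) has_real_derivative c * flat c (n + 2) t - n * flat c (n + 1) t) (at t)"
      using 2 by (auto simp: flat_def)
    then show ?thesis
      by (rule has_field_derivative_transform_within_open[where S="{..<0}"])
         (use 2 in \<open>auto simp: flat_def\<close>)
  next
    case 3
    \<comment> \<open>At 0 the difference quotient is itself a member of the family, with the
      exponent raised by one, and so tends to 0.\<close>
    have "(\<lambda>h. (flat c n (0 + h) - flat c n 0) / h) = flat c (n + 1)"
      by (auto simp: fun_eq_iff flat_def)
    then show ?thesis using flat_tendsto_0[OF assms, of "n + 1"] 3
      by (simp add: DERIV_def) (simp add: flat_def)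
  qed
qed

text \<open>Closed under partial derivatives, so that membership yields all iterated ones at once.\<close>

inductive bump_alg :: "('a::euclidean_space \<Rightarrow> real) \<Rightarrow> bool" where
  const: "bump_alg (\<lambda>z. k)"
| flat: "c > 0 \<Longrightarrow> bump_alg (\<lambda>z. flat c n (w \<bullet> z + b))"
| add: "bump_alg f \<Longrightarrow> bump_alg g \<Longrightarrow> bump_alg (\<lambda>z. f z + g z)"
| mult: "bump_alg f \<Longrightarrow> bump_alg g \<Longrightarrow> bump_alg (\<lambda>z. f z * g z)"

lemma bump_alg_prod:
  assumes "finite I" "\<And>i. i \<in> I \<Longrightarrow> bump_alg (f i)"
  shows "bump_alg (\<lambda>z. \<Prod>i\<in>I. f i z)"
  using assms by (induction I rule: finite_induct) (auto intro: bump_alg.intros)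

lemma bump_alg_derivative:
  assumes "bump_alg f"
  shows "\<exists>D. (\<forall>x. (f has_derivative (\<lambda>h. D h x)) (at x)) \<and> (\<forall>h. bump_alg (D h))"
  using assms
proof induction
  case (const k)
  show ?case by (intro exI[of _ "\<lambda>h x. 0"]) (auto intro: bump_alg.const)
next
  case (flat c n w b)
  let ?D = "\<lambda>h x. (w \<bullet> h) * (c * flat c (n + 2) (w \<bullet> x + b) + (- real n) * flat c (n + 1) (w \<bullet> x + b))"
  have "((\<lambda>z. flat c n (w \<bullet> z + b)) has_derivative (\<lambda>h. ?D h x)) (at x)" for x
  proof -
    have "(flat c n has_derivative (\<lambda>h. h * (c * flat c (n + 2) (w \<bullet> x + b) - n * flat c (n + 1) (w \<bullet> x + b)))) (at (w \<bullet> x + b))"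
      using flat_has_derivative[OF flat, of n "w \<bullet> x + b"]
      by (simp add: has_field_derivative_def mult_commute_abs)
    moreover have "((\<lambda>z. w \<bullet> z + b) has_derivative (\<lambda>h. w \<bullet> h)) (at x)"
      by (auto intro!: derivative_eq_intros)
    ultimately show ?thesis
      using has_derivative_compose[of "\<lambda>z. w \<bullet> z + b" "\<lambda>h. w \<bullet> h" x UNIV "flat c n"] by simp
  qed
  moreover have "bump_alg (?D h)" for h
    by (intro bump_alg.intros flat)
  ultimately show ?case by (intro exI[of _ ?D]) blast
next
  case (add f g)
  then obtain D E where "\<forall>x. (f has_derivative (\<lambda>h. D h x)) (at x)" "\<forall>h. bump_alg (D h)"
    "\<forall>x. (g has_derivative (\<lambda>h. E h x)) (at x)" "\<forall>h. bump_alg (E h)" by blast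
  then show ?case
    by (intro exI[of _ "\<lambda>h x. D h x + E h x"]) (auto intro!: derivative_intros bump_alg.add)
next
  case (mult f g)
  then obtain D E where "\<forall>x. (f has_derivative (\<lambda>h. D h x)) (at x)" "\<forall>h. bump_alg (D h)"
    "\<forall>x. (g has_derivative (\<lambda>h. E h x)) (at x)" "\<forall>h. bump_alg (E h)" by blast
  then show ?case using mult
    by (intro exI[of _ "\<lambda>h x. f x * E h x + D h x * g x"])
       (auto intro!: derivative_intros bump_alg.add bump_alg.mult)
qed

lemma bump_alg_continuous: "bump_alg f \<Longrightarrow> continuous_on UNIV f"
  using bump_alg_derivative
  by (metis continuous_at_imp_continuous_on has_derivative_continuous)

text \<open>Vanishing outside \<open>K\<close> is carried through the induction: the complement of a
  closed set is open, so a derivative vanishes wherever the function does so locally.\<close>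

lemma bump_alg_iterated_partial:
  fixes f :: "'a::euclidean_space \<Rightarrow> real"
  assumes "bump_alg f" "closed K" "\<And>x. x \<notin> K \<Longrightarrow> f x = 0"
  shows "\<exists>g. bump_alg g \<and> (\<forall>x. x \<notin> K \<longrightarrow> g x = 0) \<and>
    iterated_partial bs (\<lambda>x. complex_of_real (f x)) = (\<lambda>x. complex_of_real (g x))"
proof (induction bs)
  case Nil
  then show ?case using assms by auto
next
  case (Cons b bs)
  then obtain g where g: "bump_alg g" "\<And>x. x \<notin> K \<Longrightarrow> g x = 0"
    "iterated_partial bs (\<lambda>x. complex_of_real (f x)) = (\<lambda>x. complex_of_real (g x))" by blast
  obtain D where D: "\<And>x. (g has_derivative (\<lambda>h. D h x)) (at x)" "\<And>h. bump_alg (D h)"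
    using bump_alg_derivative[OF g(1)] by blast
  have "D b x = 0" if "x \<notin> K" for x
  proof -
    have "(g has_derivative (\<lambda>h. 0)) (at x)"
      by (rule has_derivative_transform_within_open[OF has_derivative_const[of 0], of "- K"])
         (use assms(2) that g(2) in \<open>auto simp: open_Compl\<close>)
    from has_derivative_unique[OF this D(1)[of x]] show ?thesis by (metis)
  qed
  moreover have "frechet_derivative (\<lambda>x. complex_of_real (g x)) (at x) b = of_real (D b x)" for x
  proof -
    have "((\<lambda>x. complex_of_real (g x)) has_derivative (\<lambda>h. of_real (D h x))) (at x)"
      by (rule bounded_linear.has_derivative[OF bounded_linear_of_real D(1)])
    then show ?thesis by (metis frechet_derivative_at)
  qed
  ultimately show ?case
    by (intro exI[of _ "D b"]) (auto simp: g D)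
qed

lemma bump_alg_schwartz:
  assumes f: "bump_alg f" and K: "compact K" "\<And>x. x \<notin> K \<Longrightarrow> f x = 0"
  shows "schwartz (\<lambda>x. complex_of_real (f x))"
  unfolding schwartz_def
proof (intro allI impI conjI)
  fix bs :: "'a list" and x :: 'a and N :: nat
  obtain g where g: "bump_alg g" "\<And>x. x \<notin> K \<Longrightarrow> g x = 0"
    "iterated_partial bs (\<lambda>x. complex_of_real (f x)) = (\<lambda>x. complex_of_real (g x))"
    using bump_alg_iterated_partial[OF f compact_imp_closed K(2)] K(1) by blast
  obtain D where D: "\<And>x. (g has_derivative (\<lambda>h. D h x)) (at x)"
    using bump_alg_derivative[OF g(1)] by blast
  have "((\<lambda>x. complex_of_real (g x)) has_derivative (\<lambda>h. of_real (D h x))) (at x)" for x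
    by (rule bounded_linear.has_derivative[OF bounded_linear_of_real D(1)])
  then show d: "iterated_partial bs (\<lambda>x. complex_of_real (f x)) differentiable at x" for x
    unfolding g(3) differentiable_def by blast
  have "continuous_on UNIV (\<lambda>x. complex_of_real (g x))"
    by (intro continuous_on_of_real bump_alg_continuous g(1))
  then have "continuous_on K (\<lambda>x. (1 + norm x) ^ N *\<^sub>R complex_of_real (g x))"
    by (intro continuous_intros continuous_on_subset[where s=UNIV and t=K]) auto
  \<comment> \<open>The inserted 0 accounts for the points outside \<open>K\<close>; on
    \<open>K\<close> compactness bounds every polynomial weight.\<close>
  then have "bounded (insert 0 ((\<lambda>x. (1 + norm x) ^ N *\<^sub>R complex_of_real (g x)) ` K))"
    using K(1) by (simp add: compact_continuous_image compact_imp_bounded)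
  then show "bounded (range (\<lambda>x. (1 + norm x) ^ N *\<^sub>R iterated_partial bs (\<lambda>x. complex_of_real (f x)) x))"
    by (rule bounded_subset) (use g in \<open>force simp: image_iff\<close>)
qed

text \<open>A smooth minorant of the indicator of the open box that converges to it as c
  \<rightarrow> 0. Each factor depends on one inner product only, which places the product in
  \<open>bump_alg\<close>.\<close>

definition box_bump :: "real \<Rightarrow> 'a::euclidean_space \<Rightarrow> 'a \<Rightarrow> 'a \<Rightarrow> real" where
  "box_bump c a b z = (\<Prod>i\<in>Basis. flat c 0 (i \<bullet> z - a \<bullet> i) * flat c 0 (b \<bullet> i - i \<bullet> z))"

text \<open>The linear map \<open>L\<close> is there for rotated test functions; its adjoint turns
  each coordinate of \<open>L z\<close> into an inner product with \<open>z\<close>.\<close>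

lemma bump_alg_box_bump:
  fixes L :: "'a::euclidean_space \<Rightarrow> 'a"
  assumes "c > 0" "linear L"
  shows "bump_alg (\<lambda>z. box_bump c a b (L z))"
  unfolding box_bump_def
proof (intro bump_alg_prod bump_alg.mult)
  fix i :: 'a
  have eq: "i \<bullet> L z = adjoint L i \<bullet> z" for z
    by (simp add: adjoint_works[OF assms(2)] inner_commute)
  show "bump_alg (\<lambda>z. flat c 0 (i \<bullet> L z - a \<bullet> i))"
    using bump_alg.flat[OF assms(1), of 0 "adjoint L i" "- (a \<bullet> i)"] by (simp add: eq)
  show "bump_alg (\<lambda>z. flat c 0 (b \<bullet> i - i \<bullet> L z))"
    using bump_alg.flat[OF assms(1), of 0 "- adjoint L i" "b \<bullet> i"] by (simp add: eq)
qed simp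

lemma box_bump_nonneg: "0 \<le> box_bump c a b z"
  unfolding box_bump_def by (intro prod_nonneg) (auto simp: flat_def)

lemma box_bump_le_indicator:
  assumes "c > 0"
  shows "box_bump c a b z \<le> indicator (box a b) z"
proof (cases "z \<in> box a b")
  case True
  have "box_bump c a b z \<le> 1"
    unfolding box_bump_def
    by (intro prod_le_1 conjI mult_nonneg_nonneg mult_le_one) (use assms in \<open>auto simp: flat_def\<close>)
  then show ?thesis using True by simp
next
  case False
  then obtain i where "i \<in> Basis" "\<not> (a \<bullet> i < z \<bullet> i \<and> z \<bullet> i < b \<bullet> i)" by (auto simp: mem_box)
  then have "flat c 0 (i \<bullet> z - a \<bullet> i) * flat c 0 (b \<bullet> i - i \<bullet> z) = 0"
    by (auto simp: flat_def inner_commute)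
  then have "box_bump c a b z = 0"
    unfolding box_bump_def using \<open>i \<in> Basis\<close> by (meson finite_Basis prod_zero)
  then show ?thesis by simp
qed

lemma box_bump_limit:
  "(\<lambda>n. box_bump (1 / real (Suc n)) a b z) \<longlonglongrightarrow> indicator (box a b) z"
proof (cases "z \<in> box a b")
  case True
  have "(\<lambda>n. \<Prod>i\<in>Basis. flat (1 / real (Suc n)) 0 (i \<bullet> z - a \<bullet> i) * flat (1 / real (Suc n)) 0 (b \<bullet> i - i \<bullet> z))
     \<longlonglongrightarrow> (\<Prod>i\<in>(Basis::'a set). 1 * 1)"
  proof (intro tendsto_prod tendsto_mult)
    have *: "(\<lambda>n. flat (1 / real (Suc n)) 0 t) \<longlonglongrightarrow> 1" if "t > 0" for t
    proof -
      have "(\<lambda>n. exp (- (1 / real (Suc n)) / t)) \<longlonglongrightarrow> exp (- 0 / t)"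
        by (intro tendsto_intros LIMSEQ_Suc[OF lim_1_over_n]) (use that in auto)
      then show ?thesis using that by (simp add: flat_def)
    qed
    fix i :: 'a assume "i \<in> Basis"
    then show "(\<lambda>n. flat (1 / real (Suc n)) 0 (i \<bullet> z - a \<bullet> i)) \<longlonglongrightarrow> 1"
      "(\<lambda>n. flat (1 / real (Suc n)) 0 (b \<bullet> i - i \<bullet> z)) \<longlonglongrightarrow> 1"
      using True by (auto intro!: * simp: mem_box inner_commute simp del: of_nat_Suc)
  qed
  then show ?thesis using True by (simp add: box_bump_def)
next
  case False
  have "box_bump (1 / real (Suc n)) a b z = 0" for n
    using box_bump_le_indicator[of "1 / real (Suc n)" a b z] box_bump_nonneg[of "1 / real (Suc n)" a b z] False
    by simp
  then show ?thesis using False by simp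
qed

lemma box_bump_integral_limit:
  fixes M :: "'a::euclidean_space measure"
  assumes "radon_measure M"
  shows "(\<lambda>n. \<integral>z. box_bump (1 / real (Suc n)) a b z \<partial>M) \<longlonglongrightarrow> measure M (box a b)"
    and "emeasure M (box a b) < \<infinity>"
proof -
  have s: "sets M = sets borel" using assms by (simp add: radon_measure_def)
  have "emeasure M (box a b) \<le> emeasure M (cbox a b)"
    by (intro emeasure_mono box_subset_cbox) (simp add: s)
  also have "\<dots> < \<infinity>" using assms by (simp add: radon_measure_def)
  finally show fin: "emeasure M (box a b) < \<infinity>" .
  have "(\<lambda>n. \<integral>z. box_bump (1 / real (Suc n)) a b z \<partial>M) \<longlonglongrightarrow> (\<integral>z. indicator (box a b) z \<partial>M)"
  proof (rule integral_dominated_convergence[where w="indicator (box a b)"])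
    show "box_bump (1 / real (Suc n)) a b \<in> borel_measurable M" for n
      using bump_alg_continuous[OF bump_alg_box_bump[OF _ linear_ident], of "1 / real (Suc n)" a b]
      by (simp add: borel_measurable_continuous_onI measurable_cong_sets[OF s refl])
  next
    show "AE x in M. norm (box_bump (1 / real (Suc n)) a b x) \<le> indicat_real (box a b) x" for n
      using box_bump_le_indicator[of "1 / real (Suc n)" a b] box_bump_nonneg[of "1 / real (Suc n)" a b]
      by (auto simp: abs_of_nonneg)
  next
    show "AE x in M. (\<lambda>n. box_bump (1 / real (Suc n)) a b x) \<longlonglongrightarrow> indicat_real (box a b) x"
      by (intro AE_I2 box_bump_limit)
  qed (use fin in \<open>auto simp: s measurable_cong_sets[OF s refl]\<close>)
  then show "(\<lambda>n. \<integral>z. box_bump (1 / real (Suc n)) a b z \<partial>M) \<longlonglongrightarrow> measure M (box a b)"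
    by (simp add: s sets_eq_imp_space_eq[OF s])
qed

text \<open>Open boxes form an intersection-stable generator, and their measures are limits of
  integrals of box bumps. Since these are Schwartz functions, the criterion can also be applied to
  measures known only through a Fourier transform.\<close>

lemma radon_measure_eqI:
  fixes M N :: "'a::euclidean_space measure"
  assumes M: "radon_measure M" and N: "radon_measure N"
    and eq: "\<And>c a b. c > 0 \<Longrightarrow> (\<integral>z. box_bump c a b z \<partial>M) = (\<integral>z. box_bump c a b z \<partial>N)"
  shows "M = N"
proof (rule measure_eqI_generator_eq)
  let ?E = "range (\<lambda>(a, b). box a b::'a set)"
  show "Int_stable ?E"
    by (auto simp: Int_stable_def box_Int_box)
  show "?E \<subseteq> Pow UNIV" "sets M = sigma_sets UNIV ?E" "sets N = sigma_sets UNIV ?E"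
    using M N by (simp_all add: borel_eq_box radon_measure_def)
  let ?A = "\<lambda>n::nat. box (- (real n *\<^sub>R One)) (real n *\<^sub>R One) :: 'a set"
  show "range ?A \<subseteq> ?E" "(\<Union>i. ?A i) = UNIV"
    unfolding UN_box_eq_UNIV by auto
  show "emeasure M (?A i) \<noteq> \<infinity>" for i
    using box_bump_integral_limit(2)[OF M] by (metis less_irrefl)
  fix X assume "X \<in> ?E"
  then obtain a b where X: "X = box a b" by auto
  have "measure M X = measure N X"
    unfolding X
    by (rule LIMSEQ_unique[OF box_bump_integral_limit(1)[OF M]])
       (use box_bump_integral_limit(1)[OF N, of a b] eq in simp)
  then show "emeasure M X = emeasure N X"
    unfolding X using box_bump_integral_limit(2)[OF M, of a b] box_bump_integral_limit(2)[OF N, of a b]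
    by (metis emeasure_eq_ennreal_measure infinity_ennreal_def less_irrefl)
qed

section \<open>Angular modes of a measure\<close>

lemma radon_measure_integrable:
  fixes F :: "'a::euclidean_space \<Rightarrow> 'b::{banach,second_countable_topology}"
  assumes M: "radon_measure M" and F: "continuous_on UNIV F" and K: "compact K"
    and z: "\<And>z. z \<notin> K \<Longrightarrow> F z = 0"
  shows "integrable M F"
proof -
  have s: "sets M = sets borel" using M by (simp add: radon_measure_def)
  have Ks: "K \<in> sets M" using K by (simp add: s borel_compact)
  have "bounded (F ` K)"
    by (intro compact_imp_bounded compact_continuous_image continuous_on_subset[OF F] K) auto
  then obtain B where B: "\<And>x. x \<in> K \<Longrightarrow> norm (F x) \<le> B"
    by (auto simp: bounded_iff)
  have "integrable M (\<lambda>x. indicator K x *\<^sub>R B)"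
    using M K Ks by (intro integrable_scaleR_left integrable_real_indicator) (auto simp: radon_measure_def)
  then show ?thesis
  proof (rule Bochner_Integration.integrable_bound)
    show "F \<in> borel_measurable M"
      using F by (simp add: borel_measurable_continuous_onI measurable_cong_sets[OF s refl])
    show "AE x in M. norm (F x) \<le> norm (indicat_real K x *\<^sub>R B)"
      using B z by (intro AE_I2) (force simp: indicator_def)
  qed
qed

lemma vimage_rotation:
  assumes "cmod u = 1"
  shows "(*) u -` K = (*) (cnj u) ` K"
proof -
  have "u * cnj u = 1" using assms complex_norm_square[of u] by simp
  then have 1: "cnj u * (u * z) = z" and 2: "u * (cnj u * z) = z" for z
    by (simp_all add: mult.assoc[symmetric] mult.commute[of "cnj u"])
  show ?thesis
  proof (intro equalityI subsetI)
    fix z assume "z \<in> (*) u -` K"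
    then show "z \<in> (*) (cnj u) ` K" by (intro image_eqI[of _ _ "u * z"]) (simp_all add: 1)
  qed (auto simp: 2)
qed

lemma measurable_rotation:
  assumes "sets M = sets borel"
  shows "(*) (u::complex) \<in> measurable M borel"
  unfolding measurable_cong_sets[OF assms refl]
  by (intro borel_measurable_continuous_onI continuous_intros)

lemma radon_measure_rotated:
  assumes M: "radon_measure M" and u: "cmod u = 1"
  shows "radon_measure (rotated_measure u M)"
proof -
  have s: "sets M = sets borel" using M by (simp add: radon_measure_def)
  have "emeasure (distr M borel ((*) u)) K < \<infinity>" if K: "compact K" for K
  proof -
    have "compact ((*) (cnj u) ` K)"
      by (intro compact_continuous_image continuous_intros K)
    then have "emeasure M ((*) u -` K) < \<infinity>"
      using M by (simp add: vimage_rotation[OF u] radon_measure_def)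
    then show ?thesis
      using K measurable_rotation[OF s] 
      by (subst emeasure_distr) (auto simp: sets_eq_imp_space_eq[OF s] borel_compact)
  qed
  then show ?thesis by (simp add: radon_measure_def rotated_measure_def)
qed

text \<open>Real polynomials in the plane, written in the coordinates that diagonalise rotations: a
  unit \<open>u\<close> multiplies the monomial by \<open>u\<close> to the integer power a -
  b.\<close>

inductive zpoly :: "(complex \<Rightarrow> complex) \<Rightarrow> bool" where
  monom: "zpoly (\<lambda>z. k * (z ^ a * cnj z ^ b))"
| add: "zpoly f \<Longrightarrow> zpoly g \<Longrightarrow> zpoly (\<lambda>z. f z + g z)"

lemma zpoly_mult:
  assumes "zpoly f" "zpoly g"
  shows "zpoly (\<lambda>z. f z * g z)"
  using assms(1)
proof induction
  case (monom k a b)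
  show ?case using assms(2)
  proof induction
    case (monom l c d)
    show ?case using zpoly.monom[of "k * l" "a + c" "b + d"]
      by (simp add: power_add mult_ac)
  next
    case (add f g)
    then show ?case using zpoly.add by (fastforce simp: distrib_left)
  qed
next
  case (add f1 f2)
  then show ?case using zpoly.add by (fastforce simp: distrib_right)
qed

lemma zpoly_real_polynomial:
  "real_polynomial_function p \<Longrightarrow> zpoly (\<lambda>z. complex_of_real (p z))"
proof (induction rule: real_polynomial_function.induct)
  case (linear f)
  have fz: "f z = Re z * f 1 + Im z * f \<i>" for z
  proof -
    have "z = Re z *\<^sub>R 1 + Im z *\<^sub>R \<i>" by (simp add: complex_eq_iff)
    then have "f z = f (Re z *\<^sub>R 1 + Im z *\<^sub>R \<i>)" by simp
    then show ?thesis using linear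
      by (simp add: bounded_linear.linear linear_add linear_scale)
  qed
  \<comment> \<open>From Re z = (z + cnj z)/2 and Im z = (z - cnj z)/(2\<i>).\<close>
  define k l where "k = (f 1 - \<i> * f \<i>) / 2" and "l = (f 1 + \<i> * f \<i>) / 2"
  have "(\<lambda>z. complex_of_real (f z)) = (\<lambda>z. k * (z ^ 1 * cnj z ^ 0) + l * (z ^ 0 * cnj z ^ 1))"
  proof
    fix z
    have "complex_of_real (Re z * f 1 + Im z * f \<i>) = k * (z ^ 1 * cnj z ^ 0) + l * (z ^ 0 * cnj z ^ 1)"
      by (simp add: k_def l_def complex_eq_iff field_simps)
    then show "complex_of_real (f z) = k * (z ^ 1 * cnj z ^ 0) + l * (z ^ 0 * cnj z ^ 1)"
      by (simp only: fz[of z])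
  qed
  then show ?case using zpoly.add[OF zpoly.monom zpoly.monom, of k 1 0 l 0 1] by (simp only:)
next
  case (const c)
  show ?case using zpoly.monom[of c 0 0] by simp
next
  case (add f g)
  show ?case using zpoly.add[OF add.IH] by simp
next
  case (mult f g)
  show ?case using zpoly_mult[OF mult.IH] by simp
qed

lemma zpoly_continuous: "zpoly q \<Longrightarrow> continuous_on S q"
  by (induction rule: zpoly.induct) (auto intro!: continuous_intros)

text \<open>Positive \<open>m\<close> suffices as a condition: a measure gives conjugate integrals
  to conjugate functions, which covers negative modes, and functions of mode 0 are rotation
  invariant anyway.\<close>

definition no_angular_modes :: "complex measure \<Rightarrow> bool" where
  "no_angular_modes \<gamma> \<longleftrightarrow> (\<forall>(m::nat) F \<rho>. m > 0 \<and> continuous_on UNIV F \<and> (\<forall>z. cmod z > \<rho> \<longrightarrow> F z = 0) \<and>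
      (\<forall>u z. cmod u = 1 \<longrightarrow> F (u * z) = u ^ m * F z) \<longrightarrow> (\<integral>z. F z \<partial>\<gamma>) = (0::complex))"

text \<open>The radial weight makes a polynomial compactly supported without changing its angular
  modes. A monomial with a = b is invariant; for a \<noteq> b both integrals vanish, directly if a >
  b and by conjugation if a < b.\<close>

lemma zpoly_integral_rotate:
  fixes \<eta> :: "real \<Rightarrow> real" and q :: "complex \<Rightarrow> complex"
  assumes \<gamma>: "radon_measure \<gamma>" and modes: "no_angular_modes \<gamma>" and u: "cmod u = 1"
    and \<eta>: "continuous_on UNIV \<eta>" "\<And>t. t > r \<Longrightarrow> \<eta> t = 0" and q: "zpoly q"
  shows "(\<integral>z. \<eta> (cmod z) * q (u * z) \<partial>\<gamma>) = (\<integral>z. \<eta> (cmod z) * q z \<partial>\<gamma>)"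
  using q
proof induction
  case (monom k a b)
  let ?F = "\<lambda>a b z. of_real (\<eta> (cmod z)) * (z ^ a * cnj z ^ b)"
  have cont: "continuous_on UNIV (?F a b)" for a b
    by (intro continuous_intros continuous_on_compose2[OF \<eta>(1)]) auto
  have gt: "(\<integral>z. ?F a b z \<partial>\<gamma>) = 0" if "a > b" for a b
  proof -
    have "?F a b (u * z) = u ^ (a - b) * ?F a b z" if u: "cmod u = 1" for u z
    proof -
      have "u * cnj u = 1" using u complex_norm_square[of u] by simp
      then have "u ^ b * cnj u ^ b = 1" by (metis power_mult_distrib power_one)
      moreover have "u ^ a = u ^ (a - b) * u ^ b" using \<open>a > b\<close> by (simp flip: power_add)
      ultimately have "u ^ a * cnj u ^ b = u ^ (a - b)" by (simp add: mult.assoc)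
      moreover have "?F a b (u * z) = of_real (\<eta> (cmod z)) * ((u ^ a * cnj u ^ b) * (z ^ a * cnj z ^ b))"
        using u by (simp add: norm_mult power_mult_distrib mult_ac)
      ultimately show ?thesis by (simp only: mult.left_commute)
    qed
    then show ?thesis
      using \<open>a > b\<close> cont[of a b] \<eta>(2)
      by (intro modes[unfolded no_angular_modes_def, rule_format, of "a - b" "?F a b" r]) auto
  qed
  have zero: "(\<integral>z. ?F a b z \<partial>\<gamma>) = 0" if "a \<noteq> b"
  proof (cases "a > b")
    case False
    then have "(\<integral>z. ?F b a z \<partial>\<gamma>) = 0" using that gt by simp
    then have "(\<integral>z. cnj (?F b a z) \<partial>\<gamma>) = 0"
      using Bochner_Integration.integral_cnj[of \<gamma> "?F b a"] by (simp only: complex_cnj_zero)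
    moreover have "cnj (?F b a z) = ?F a b z" for z by (simp add: mult.commute)
    ultimately show ?thesis by (simp only:)
  qed (use gt in auto)
  have "(\<integral>z. \<eta> (cmod z) * (k * ((u * z) ^ a * cnj (u * z) ^ b)) \<partial>\<gamma>) =
      (\<integral>z. \<eta> (cmod z) * (k * (z ^ a * cnj z ^ b)) \<partial>\<gamma>)"
  proof (cases "a = b")
    case True
    have "u * cnj u = 1" using u complex_norm_square[of u] by simp
    then have "u ^ b * cnj u ^ b = 1" by (metis power_mult_distrib power_one)
    moreover have "(u * z) ^ b * cnj (u * z) ^ b = (u ^ b * cnj u ^ b) * (z ^ b * cnj z ^ b)" for z
      by (simp add: power_mult_distrib mult_ac)
    ultimately have "(u * z) ^ a * cnj (u * z) ^ b = z ^ a * cnj z ^ b" for z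
      using True by (simp only: mult_1_left)
    then show ?thesis by simp
  next
    case False
    have 1: "\<eta> (cmod z) * (k * ((u * z) ^ a * cnj (u * z) ^ b)) = (k * u ^ a * cnj u ^ b) * ?F a b z" for z
      by (simp add: power_mult_distrib)
    have 2: "\<eta> (cmod z) * (k * (z ^ a * cnj z ^ b)) = k * ?F a b z" for z
      by simp
    show ?thesis unfolding 1 2 using zero[OF False] by simp
  qed
  then show ?case .
next
  case (add f g)
  have "integrable \<gamma> (\<lambda>z. complex_of_real (\<eta> (cmod z)) * f (v * z))" if "zpoly f" for f v
  proof (rule radon_measure_integrable[OF \<gamma> _ compact_cball[of 0 r]])
    show "continuous_on UNIV (\<lambda>z. complex_of_real (\<eta> (cmod z)) * f (v * z))"
      by (intro continuous_intros continuous_on_compose2[OF \<eta>(1)]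
        continuous_on_compose2[OF zpoly_continuous[OF that]]) auto
  qed (use \<eta>(2) in auto)
  from this[OF add.hyps(1), of u] this[OF add.hyps(1), of 1] this[OF add.hyps(2), of u] this[OF add.hyps(2), of 1]
  show ?case using add.IH by (simp add: distrib_left)
qed

lemma no_angular_modes_integral_rotate:
  fixes f :: "complex \<Rightarrow> real"
  assumes \<gamma>: "radon_measure \<gamma>" and modes: "no_angular_modes \<gamma>" and u: "cmod u = 1"
    and f: "continuous_on UNIV f" "\<And>z. cmod z > r \<Longrightarrow> f z = 0"
  shows "(\<integral>z. f (u * z) \<partial>\<gamma>) = (\<integral>z. f z \<partial>\<gamma>)"
proof -
  \<comment> \<open>Equal to 1 on the ball that carries \<open>f\<close> and to 0 beyond radius r +
    1. Multiplying an approximating polynomial by it controls the error on the whole plane, although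
    the approximation is valid on the larger ball only.\<close>
  define \<eta> where "\<eta> t = max 0 (min 1 (r + 1 - t))" for t :: real
  have \<eta>: "continuous_on UNIV \<eta>" unfolding \<eta>_def by (intro continuous_intros)
  have \<eta>0: "\<eta> t = 0" if "t > r + 1" for t using that by (simp add: \<eta>_def)
  have \<eta>01: "0 \<le> \<eta> t" "\<eta> t \<le> 1" for t by (auto simp: \<eta>_def)
  have f\<eta>: "f z = \<eta> (cmod z) * f z" for z
    using f(2)[of z] by (cases "cmod z > r") (auto simp: \<eta>_def)
  let ?C = "cball 0 (r + 1) :: complex set"
  define m where "m = measure \<gamma> ?C"
  have s: "sets \<gamma> = sets borel" using \<gamma> by (simp add: radon_measure_def)
  have fin: "emeasure \<gamma> ?C < \<infinity>" using \<gamma> by (simp add: radon_measure_def)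
  have close: "\<bar>(\<integral>z. f (v * z) \<partial>\<gamma>) - (\<integral>z. \<eta> (cmod z) * p (v * z) \<partial>\<gamma>)\<bar> \<le> e * m"
    if e: "e > 0" and p: "real_polynomial_function p" "\<And>z. z \<in> ?C \<Longrightarrow> \<bar>f z - p z\<bar> < e"
      and v: "cmod v = 1" for e p v
  proof -
    have contp: "continuous_on S p" for S
      using continuous_on_polymonial_function[of p S] p(1) by (simp add: real_polynomial_function_eq)
    have i1: "integrable \<gamma> (\<lambda>z. f (v * z))"
      by (rule radon_measure_integrable[OF \<gamma> _ compact_cball[of 0 r]])
         (use f v in \<open>auto intro!: continuous_intros continuous_on_compose2[OF f(1)] simp: norm_mult\<close>)
    have i2: "integrable \<gamma> (\<lambda>z. \<eta> (cmod z) * p (v * z))"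
      by (rule radon_measure_integrable[OF \<gamma> _ compact_cball[of 0 "r + 1"]])
         (use \<eta>0 in \<open>auto intro!: continuous_intros continuous_on_compose2[OF \<eta>] continuous_on_compose2[OF contp[of UNIV]]\<close>)
    have "\<bar>(\<integral>z. f (v * z) \<partial>\<gamma>) - (\<integral>z. \<eta> (cmod z) * p (v * z) \<partial>\<gamma>)\<bar> =
        \<bar>\<integral>z. f (v * z) - \<eta> (cmod z) * p (v * z) \<partial>\<gamma>\<bar>"
      using i1 i2 by simp
    also have "\<dots> \<le> (\<integral>z. indicator ?C z *\<^sub>R e \<partial>\<gamma>)"
    proof (rule order_trans[OF integral_abs_bound], rule integral_mono)
      show "integrable \<gamma> (\<lambda>z. \<bar>f (v * z) - \<eta> (cmod z) * p (v * z)\<bar>)"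
        using i1 i2 by simp
      show "integrable \<gamma> (\<lambda>z. indicat_real ?C z *\<^sub>R e)"
        using fin by (intro integrable_scaleR_left integrable_real_indicator) (auto simp: s)
      fix z
      have "f (v * z) - \<eta> (cmod z) * p (v * z) = \<eta> (cmod z) * (f (v * z) - p (v * z))"
        using f\<eta>[of "v * z"] v by (simp add: norm_mult right_diff_distrib)
      moreover have "\<eta> (cmod z) * \<bar>f (v * z) - p (v * z)\<bar> \<le> indicat_real ?C z *\<^sub>R e"
      proof (cases "z \<in> ?C")
        case True
        then have "\<bar>f (v * z) - p (v * z)\<bar> < e" using p(2)[of "v * z"] v by (simp add: norm_mult)
        then have "\<eta> (cmod z) * \<bar>f (v * z) - p (v * z)\<bar> \<le> 1 * e"
          by (intro mult_mono) (use \<eta>01 in auto)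
        then show ?thesis using True by simp
      qed (use \<eta>0 in auto)
      ultimately show "\<bar>f (v * z) - \<eta> (cmod z) * p (v * z)\<bar> \<le> indicat_real ?C z *\<^sub>R e"
        using \<eta>01 by (simp add: abs_mult)
    qed
    also have "\<dots> = e * m" by (simp add: m_def s sets_eq_imp_space_eq[OF s])
    finally show ?thesis .
  qed
  have "\<bar>(\<integral>z. f (u * z) \<partial>\<gamma>) - (\<integral>z. f z \<partial>\<gamma>)\<bar> \<le> e" if "e > 0" for e
  proof -
    have m0: "m \<ge> 0" by (simp add: m_def)
    \<comment> \<open>Two errors of size at most e' * m must add up to at most e; the summand 1
      covers m = 0.\<close>
    define e' where "e' = e / (2 * (m + 1))"
    have e': "e' > 0" using that m0 by (simp add: e'_def)
    obtain p where p: "real_polynomial_function p" "\<And>z. z \<in> ?C \<Longrightarrow> \<bar>f z - p z\<bar> < e'"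
      using Stone_Weierstrass_real_polynomial_function[OF compact_cball[of "0::complex" "r + 1"] continuous_on_subset[OF f(1)] e']
      by blast
    have "complex_of_real (\<integral>z. \<eta> (cmod z) * p (u * z) \<partial>\<gamma>) = complex_of_real (\<integral>z. \<eta> (cmod z) * p z \<partial>\<gamma>)"
      using zpoly_integral_rotate[OF \<gamma> modes u \<eta> \<eta>0 zpoly_real_polynomial[OF p(1)]]
      by (simp flip: of_real_mult)
    then have "(\<integral>z. \<eta> (cmod z) * p (u * z) \<partial>\<gamma>) = (\<integral>z. \<eta> (cmod z) * p z \<partial>\<gamma>)"
      by (simp only: of_real_eq_iff)
    then have "\<bar>(\<integral>z. f (u * z) \<partial>\<gamma>) - (\<integral>z. f z \<partial>\<gamma>)\<bar> \<le> 2 * (e' * m)"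
      using close[OF e' p u] close[OF e' p, of 1] by simp
    also have "\<dots> \<le> e" using m0 that unfolding e'_def by (simp add: field_simps)
    finally show ?thesis .
  qed
  then have "\<bar>(\<integral>z. f (u * z) \<partial>\<gamma>) - (\<integral>z. f z \<partial>\<gamma>)\<bar> \<le> 0"
    by (rule field_le_epsilon) simp
  then show ?thesis by simp
qed

lemma box_bump_zero_outside:
  fixes a b :: "'a::euclidean_space"
  obtains r where "\<And>c z. c > 0 \<Longrightarrow> norm z > r \<Longrightarrow> box_bump c a b z = 0"
proof -
  obtain r where r: "\<forall>z\<in>box a b. norm z \<le> r"
    using bounded_box[of a b] unfolding bounded_iff ..
  show thesis
  proof
    fix c :: real and z :: 'a assume "c > 0" "norm z > r"
    then have "z \<notin> box a b" using r by (meson not_less)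
    then show "box_bump c a b z = 0"
      using box_bump_le_indicator[OF \<open>c > 0\<close>, of a b z] box_bump_nonneg[of c a b z] by simp
  qed
qed

lemma no_angular_modes_rotated:
  assumes \<gamma>: "radon_measure \<gamma>" and modes: "no_angular_modes \<gamma>" and u: "cmod u = 1"
  shows "rotated_measure u \<gamma> = \<gamma>"
proof (rule radon_measure_eqI[OF radon_measure_rotated[OF \<gamma> u] \<gamma>])
  fix c :: real and a b :: complex assume c: "c > 0"
  have s: "sets \<gamma> = sets borel" using \<gamma> by (simp add: radon_measure_def)
  obtain r where r: "\<And>z. cmod z > r \<Longrightarrow> box_bump c a b z = 0"
    using box_bump_zero_outside[of a b] c by metis
  have cont: "continuous_on UNIV (box_bump c a b)"
    using bump_alg_continuous[OF bump_alg_box_bump[OF c linear_ident]] .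
  show "(\<integral>z. box_bump c a b z \<partial>rotated_measure u \<gamma>) = (\<integral>z. box_bump c a b z \<partial>\<gamma>)"
    unfolding rotated_measure_def
    using no_angular_modes_integral_rotate[OF \<gamma> modes u cont r]
    by (subst integral_distr[OF measurable_rotation[OF s]])
       (simp_all add: borel_measurable_continuous_onI cont)
qed

section \<open>Rotation invariance under the Fourier transform\<close>

lemma fourier_rotate:
  assumes u: "cmod u = 1" and f: "f \<in> borel_measurable borel"
  shows "fourier (\<lambda>z. f (u * z)) k = fourier f (u * k)"
proof -
  have cis: "(\<lambda>x. cis (- 2 * pi * ((u * k) \<bullet> x))) \<in> borel_measurable borel"
    by (intro borel_measurable_continuous_onI continuous_intros)
  have "fourier f (u * k) = (\<integral>x. cis (- 2 * pi * ((u * k) \<bullet> x)) * f x \<partial>distr lborel borel ((*) u))"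
    by (simp add: fourier_def lborel_distr_rotation[OF u])
  also have "\<dots> = (\<integral>x. cis (- 2 * pi * ((u * k) \<bullet> (u * x))) * f (u * x) \<partial>lborel)"
    by (rule integral_distr[OF measurable_rotation[OF sets_lborel] borel_measurable_times[OF cis f]])
  also have "\<dots> = fourier (\<lambda>z. f (u * z)) k"
  proof -
    have "(u * k) \<bullet> (u * x) = (Re u ^ 2 + Im u ^ 2) * (k \<bullet> x)" for x
      by (simp add: inner_complex_def algebra_simps power2_eq_square)
    moreover have "Re u ^ 2 + Im u ^ 2 = 1" using u by (simp add: cmod_def)
    ultimately show ?thesis by (simp add: fourier_def)
  qed
  finally show ?thesis ..
qed

lemma borel_measurable_fourier:
  fixes f :: "'a::euclidean_space \<Rightarrow> complex"
  assumes [measurable]: "f \<in> borel_measurable borel"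
  shows "fourier f \<in> borel_measurable borel"
proof -
  have [measurable]: "cis \<in> borel_measurable borel"
    by (intro borel_measurable_continuous_onI continuous_intros)
  show ?thesis unfolding fourier_def by measurable
qed

text \<open>Rotating a test function rotates its Fourier transform by the same angle, and there the
  rotation is absorbed by \<gamma>. Box bumps suffice as test functions, and their rotated copies
  are Schwartz functions too.\<close>

lemma fourier_measure_circular_symmetric:
  assumes \<gamma>: "\<And>u. cmod u = 1 \<Longrightarrow> rotated_measure u \<gamma> = \<gamma>" and \<mu>: "fourier_measure \<gamma> \<mu>"
  shows "circular_symmetric \<mu>"
  unfolding circular_symmetric_def
proof (intro allI impI)
  fix u :: complex assume u: "cmod u = 1"
  have rad: "radon_measure \<mu>" "radon_measure \<gamma>" using \<mu> by (auto simp: fourier_measure_def)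
  then have s: "sets \<mu> = sets borel" "sets \<gamma> = sets borel" by (auto simp: radon_measure_def)
  show "rotated_measure u \<mu> = \<mu>"
  proof (rule radon_measure_eqI[OF radon_measure_rotated[OF rad(1) u] rad(1)])
    fix c :: real and a b :: complex assume c: "c > 0"
    let ?f = "box_bump c a b"
    let ?g = "\<lambda>z. complex_of_real (?f z)"
    obtain r where r: "\<And>z. cmod z > r \<Longrightarrow> ?f z = 0"
      using box_bump_zero_outside[of a b] c by metis
    have cont: "continuous_on UNIV ?f"
      using bump_alg_continuous[OF bump_alg_box_bump[OF c linear_ident]] .
    then have bm: "?f \<in> borel_measurable borel" by (simp add: borel_measurable_continuous_onI)
    then have bg: "?g \<in> borel_measurable borel" by simp
    have sch: "schwartz (\<lambda>z. ?g (v * z))" if "cmod v = 1" for v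
      by (rule bump_alg_schwartz[OF bump_alg_box_bump[OF c linear_times] compact_cball[of 0 r]])
         (use r that in \<open>auto simp: norm_mult\<close>)
    have "complex_of_real (\<integral>z. ?f (u * z) \<partial>\<mu>) = (\<integral>z. ?g (u * z) \<partial>\<mu>)" by simp
    also have "\<dots> = (\<integral>k. fourier (\<lambda>z. ?g (u * z)) k \<partial>\<gamma>)"
      using \<mu> sch[OF u] unfolding fourier_measure_def by blast
    also have "\<dots> = (\<integral>k. fourier ?g (u * k) \<partial>\<gamma>)" by (simp only: fourier_rotate[OF u bg])
    also have "\<dots> = (\<integral>k. fourier ?g k \<partial>rotated_measure u \<gamma>)"
      unfolding rotated_measure_def
      by (rule integral_distr[symmetric, OF measurable_rotation[OF s(2)] borel_measurable_fourier[OF bg]])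
    also have "\<dots> = (\<integral>k. fourier ?g k \<partial>\<gamma>)" by (simp only: \<gamma>[OF u])
    also have "\<dots> = (\<integral>z. ?g z \<partial>\<mu>)"
    proof -
      have "schwartz ?g" using sch[of 1] by simp
      then show ?thesis using \<mu> unfolding fourier_measure_def by metis
    qed
    also have "\<dots> = complex_of_real (\<integral>z. ?f z \<partial>\<mu>)" by simp
    finally have "(\<integral>z. ?f (u * z) \<partial>\<mu>) = (\<integral>z. ?f z \<partial>\<mu>)" by (simp only: of_real_eq_iff)
    then show "(\<integral>z. ?f z \<partial>rotated_measure u \<mu>) = (\<integral>z. ?f z \<partial>\<mu>)"
      unfolding rotated_measure_def
      by (subst integral_distr[OF measurable_rotation[OF s(1)] bm])
  qed
qed

section \<open>Similarities, tiles and boundary layers\<close>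

lemma similarity_eq: "(\<lambda>z. w * z + v) ` S = (+) v ` ((*) w ` S)" for w v :: complex
  by (simp add: image_image add.commute)

lemma inj_similarity: "w \<noteq> 0 \<Longrightarrow> inj (\<lambda>z. w * z + v)" for w v :: complex
  by (auto simp: inj_def)

lemma interior_similarity:
  fixes w v :: complex
  assumes "w \<noteq> 0"
  shows "interior ((\<lambda>z. w * z + v) ` S) = (\<lambda>z. w * z + v) ` interior S"
  unfolding similarity_eq interior_translation
  by (subst interior_injective_linear_image) (use assms in \<open>auto simp: inj_def linear_times\<close>)

lemma closure_similarity:
  fixes w v :: complex
  assumes "w \<noteq> 0"
  shows "closure ((\<lambda>z. w * z + v) ` S) = (\<lambda>z. w * z + v) ` closure S"
  unfolding similarity_eq closure_translation
  by (subst closure_injective_linear_image) (use assms in \<open>auto simp: inj_def linear_times\<close>)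

lemma borel_similarity:
  fixes w v :: complex
  assumes "w \<noteq> 0" "S \<in> sets borel"
  shows "(\<lambda>z. w * z + v) ` S \<in> sets borel"
proof -
  have "(\<lambda>z. w * z + v) ` S = (\<lambda>z. (z - v) / w) -` S"
  proof (intro equalityI subsetI)
    fix z assume "z \<in> (\<lambda>z. (z - v) / w) -` S"
    then show "z \<in> (\<lambda>z. w * z + v) ` S"
      using assms(1) by (intro image_eqI[of _ _ "(z - v) / w"]) auto
  qed (use assms(1) in auto)
  moreover have "(\<lambda>z. (z - v) / w) \<in> borel_measurable borel"
    by (intro borel_measurable_continuous_onI continuous_intros) (use assms in auto)
  from measurable_sets[OF this assms(2)] have "(\<lambda>z. (z - v) / w) -` S \<in> sets borel" by simp
  ultimately show ?thesis by simp
qed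

lemma measure_similarity:
  fixes w v :: complex
  assumes w: "w \<noteq> 0" and S: "S \<in> sets borel"
  shows "measure lborel ((\<lambda>z. w * z + v) ` S) = (cmod w)\<^sup>2 * measure lborel S"
proof -
  \<comment> \<open>Split \<open>w\<close> into a dilation by \<open>cmod w\<close>, which
    contributes the square, and a rotation, which preserves area.\<close>
  define u where "u = w / cmod w"
  have u: "cmod u = 1" using w by (simp add: u_def norm_divide)
  then have u0: "u \<noteq> 0" by auto
  have w_eq: "w = cmod w * u" using w by (simp add: u_def)
  have bS: "(*) u ` S \<in> sets borel" using borel_similarity[OF u0 S, of 0] by simp
  have bw: "(\<lambda>z. w * z + v) ` S \<in> sets borel" by (rule borel_similarity[OF w S])
  have "(\<lambda>z. w * z + v) ` S = (\<lambda>z. cmod w *\<^sub>R z + v) ` ((*) u ` S)"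
    by (subst w_eq) (simp add: image_image scaleR_conv_of_real mult.assoc)
  then have "measure lborel ((\<lambda>z. w * z + v) ` S) = (cmod w)\<^sup>2 * measure lborel ((*) u ` S)"
    using measure_lebesgue_affine[of "cmod w" v "(*) u ` S"] bS bw
    by (simp add: measure_completion)
  also have "measure lborel ((*) u ` S) = measure (distr lborel borel ((*) u)) ((*) u ` S)"
    by (simp add: lborel_distr_rotation[OF u])
  also have "\<dots> = measure lborel ((*) u -` ((*) u ` S))"
    using bS by (subst measure_distr) (auto intro!: borel_measurable_continuous_onI continuous_intros)
  also have "(*) u -` ((*) u ` S) = S" using u0 by (intro inj_vimage_image_eq) (auto simp: inj_def)
  finally show ?thesis .
qed

lemma place_move [simp]: "place (move u v T) z = u * place T z + v"
  by (simp add: place_def move_def algebra_simps)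

lemma proto_move [simp]: "proto (move u v T) = proto T"
  and rot_move [simp]: "rot (move u v T) = u * rot T"
  and shift_move [simp]: "shift (move u v T) = u * shift T + v"
  by (simp_all add: move_def)

lemma move_move [simp]: "move u v (move u' v' T) = move (u * u') (u * v' + v) T"
  by (simp add: move_def algebra_simps)

lemma move_1_0 [simp]: "move 1 0 T = T"
  by (simp add: move_def)

lemma move_Tile: "T = move (rot T) (shift T) (Tile (proto T) 1 0)"
  by (simp add: move_def)

lemma support_move: "support P (move u v T) = (\<lambda>z. u * z + v) ` support P T"
  by (simp add: support_def image_image)

lemma support_similarity: "support P T = (\<lambda>z. rot T * z + shift T) ` P (proto T)"
  by (simp add: support_def place_def)

lemma move_tiles: "cmod u = 1 \<Longrightarrow> T \<in> tiles \<Longrightarrow> move u v T \<in> tiles"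
  by (simp add: tiles_def norm_mult)

lemma non_overlapping_subset: "non_overlapping P G \<Longrightarrow> F \<subseteq> G \<Longrightarrow> non_overlapping P F"
  unfolding non_overlapping_def by (rule pairwise_subset)

lemma non_overlapping_move:
  assumes "cmod u = 1" "non_overlapping P F"
  shows "non_overlapping P (move u v ` F)"
proof -
  have "u \<noteq> 0" using assms by auto
  show ?thesis
    unfolding non_overlapping_def
  proof (intro pairwiseI)
    fix S T assume "S \<in> move u v ` F" "T \<in> move u v ` F" "S \<noteq> T"
    then obtain S' T' where *: "S = move u v S'" "T = move u v T'" "S' \<in> F" "T' \<in> F" "S' \<noteq> T'"
      by blast
    then have "disjnt (interior (support P S')) (interior (support P T'))"
      using assms(2) by (auto simp: non_overlapping_def pairwise_def)
    then show "disjnt (interior (support P S)) (interior (support P T))"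
      using \<open>u \<noteq> 0\<close> inj_similarity[of u v]
      by (auto simp: * support_move interior_similarity disjnt_def inj_def)
  qed
qed

lemma subst_tile_move: "subst_tile l \<sigma> (move u v T) = move u (l *\<^sub>R v) ` subst_tile l \<sigma> T"
  by (simp add: subst_tile_def image_image algebra_simps)

lemma subst_move: "subst l \<sigma> (move u v ` F) = move u (l *\<^sub>R v) ` subst l \<sigma> F"
  by (auto simp: subst_def subst_tile_move)

lemma subst_iterate_move:
  "(subst l \<sigma> ^^ k) (move u v ` F) = move u (l ^ k *\<^sub>R v) ` (subst l \<sigma> ^^ k) F"
  by (induction k) (simp_all add: subst_move)

lemma subst_iterate_UN: "(subst l \<sigma> ^^ k) F = (\<Union>T\<in>F. (subst l \<sigma> ^^ k) {T})"
proof (induction k)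
  case (Suc k)
  have "subst l \<sigma> (\<Union>T\<in>F. (subst l \<sigma> ^^ k) {T}) = (\<Union>T\<in>F. subst l \<sigma> ((subst l \<sigma> ^^ k) {T}))"
    by (auto simp: subst_def)
  then show ?case using Suc by simp
qed auto

lemma subst_iterate_mono: "F \<subseteq> G \<Longrightarrow> (subst l \<sigma> ^^ k) F \<subseteq> (subst l \<sigma> ^^ k) G"
  by (induction k) (auto simp: subst_def)

lemma subst_iterate_tile:
  "(subst l \<sigma> ^^ k) {T} = move (rot T) (l ^ k *\<^sub>R shift T) ` supertile l \<sigma> k (proto T)"
  using subst_iterate_move[of k l \<sigma> "rot T" "shift T" "{Tile (proto T) 1 0}"] move_Tile[of T]
  by (simp add: supertile_def)

lemma subst_iterate_supertile: "(subst l \<sigma> ^^ k) (supertile l \<sigma> n i) = supertile l \<sigma> (k + n) i"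
  by (simp add: supertile_def funpow_add)

section \<open>Boundary layers of a set\<close>

definition layer :: "real \<Rightarrow> complex set \<Rightarrow> complex set" where
  "layer e S = {z \<in> S. \<not> cball z e \<subseteq> interior S}"

lemma closed_layer:
  assumes "closed S"
  shows "closed (layer e S)"
\<comment> \<open>If the interior is everything, its complement is empty and \<open>infdist\<close>
  takes the default value 0, whereas the layer is empty.\<close>
proof (cases "interior S = UNIV \<or> e < 0")
  case True
  then have "layer e S = {}" by (auto simp: layer_def)
  then show ?thesis by simp
next
  case False
  then have ne: "- interior S \<noteq> {}" by auto
  have cl: "closed (- interior S)" by (simp add: closed_Compl)
  have "\<not> cball z e \<subseteq> interior S \<longleftrightarrow> infdist z (- interior S) \<le> e" for z
  proof
    assume "\<not> cball z e \<subseteq> interior S"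
    then obtain y where "y \<in> - interior S" "dist z y \<le> e" by (auto simp: subset_iff)
    then show "infdist z (- interior S) \<le> e" by (rule infdist_le2)
  next
    assume "infdist z (- interior S) \<le> e"
    moreover obtain y where "y \<in> - interior S" "infdist z (- interior S) = dist z y"
      using infdist_attains_inf[OF cl ne] by blast
    ultimately show "\<not> cball z e \<subseteq> interior S" by (auto simp: subset_iff)
  qed
  then have "layer e S = S \<inter> {z. infdist z (- interior S) \<le> e}" by (auto simp: layer_def)
  then show ?thesis
    using assms by (simp add: closed_Int closed_Collect_le continuous_on_infdist)
qed

lemma layer_similarity:
  fixes w v :: complex
  assumes w: "w \<noteq> 0"
  shows "layer (cmod w * e) ((\<lambda>z. w * z + v) ` S) = (\<lambda>z. w * z + v) ` layer e S"
proof -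
  have c: "cball (w * z + v) (cmod w * e) = (\<lambda>z. w * z + v) ` cball z e" for z
  proof -
    have "y \<in> (\<lambda>z. w * z + v) ` cball z e" if "y \<in> cball (w * z + v) (cmod w * e)" for y
    proof (rule image_eqI)
      show "y = w * ((y - v) / w) + v" using w by simp
      have "w * z + v - y = w * (z - (y - v) / w)" using w by (simp add: field_simps)
      then have "cmod w * dist z ((y - v) / w) \<le> cmod w * e"
        using that by (metis dist_norm mem_cball norm_mult)
      then show "(y - v) / w \<in> cball z e" using w by simp
    qed
    moreover have "dist (w * z + v) (w * y + v) = cmod w * dist z y" for y
      by (simp add: dist_norm flip: norm_mult right_diff_distrib)
    ultimately show ?thesis using w by (auto simp: mult_left_mono)
  qed
  let ?\<phi> = "\<lambda>z. w * z + v"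
  have sub: "?\<phi> ` A \<subseteq> ?\<phi> ` B \<longleftrightarrow> A \<subseteq> B" for A B
    by (rule inj_image_subset_iff[OF inj_similarity[OF w]])
  have iff: "cball (?\<phi> z) (cmod w * e) \<subseteq> interior (?\<phi> ` S) \<longleftrightarrow> cball z e \<subseteq> interior S" for z
    unfolding interior_similarity[OF w] c sub ..
  show ?thesis
    unfolding layer_def
  proof (intro equalityI subsetI)
    fix y assume "y \<in> {y \<in> ?\<phi> ` S. \<not> cball y (cmod w * e) \<subseteq> interior (?\<phi> ` S)}"
    then obtain z where "z \<in> S" "y = ?\<phi> z" "\<not> cball z e \<subseteq> interior S" using iff by blast
    then show "y \<in> ?\<phi> ` {z \<in> S. \<not> cball z e \<subseteq> interior S}" by blast
  next
    fix y assume "y \<in> ?\<phi> ` {z \<in> S. \<not> cball z e \<subseteq> interior S}"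
    then obtain z where "z \<in> S" "y = ?\<phi> z" "\<not> cball z e \<subseteq> interior S" by blast
    then show "y \<in> {y \<in> ?\<phi> ` S. \<not> cball y (cmod w * e) \<subseteq> interior (?\<phi> ` S)}" using iff by blast
  qed
qed

text \<open>Continuity from above: the layers decrease to the topological boundary of
  \<open>S\<close>, whose measure may be positive for a general compact set.\<close>

lemma measure_layer_tendsto:
  assumes S: "compact S" and e: "e \<longlonglongrightarrow> 0" "decseq e" "\<And>n. e n > 0"
  shows "(\<lambda>n. measure lborel (layer (e n) S)) \<longlonglongrightarrow> measure lborel (S - interior S)"
proof -
  have "(\<Inter>n. layer (e n) S) = S - interior S"
  proof
    show "S - interior S \<subseteq> (\<Inter>n. layer (e n) S)"
    proof (intro subsetI INT_I)
      fix z n assume "z \<in> S - interior S"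
      moreover have "z \<in> cball z (e n)" using e(3)[of n] by simp
      ultimately show "z \<in> layer (e n) S" unfolding layer_def by blast
    qed
    show "(\<Inter>n. layer (e n) S) \<subseteq> S - interior S"
    proof (intro subsetI DiffI)
      fix z assume z: "z \<in> (\<Inter>n. layer (e n) S)"
      then show "z \<in> S" by (auto simp: layer_def)
      show "z \<notin> interior S"
      proof
        assume "z \<in> interior S"
        then obtain d where "d > 0" "cball z d \<subseteq> interior S"
          using open_interior open_contains_cball by blast
        moreover obtain n where "e n < d"
          using order_tendstoD(2)[OF e(1) \<open>d > 0\<close>] by (auto simp: eventually_sequentially)
        ultimately have "cball z (e n) \<subseteq> interior S" by auto
        then show False using z by (auto simp: layer_def)
      qed
    qed
  qed
  moreover have "(\<lambda>n. measure lborel (layer (e n) S)) \<longlonglongrightarrow> measure lborel (\<Inter>n. layer (e n) S)"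
  proof (rule Lim_measure_decseq)
    show "range (\<lambda>n. layer (e n) S) \<subseteq> sets lborel"
      using closed_layer[OF compact_imp_closed[OF S]] by auto
    show "decseq (\<lambda>n. layer (e n) S)"
      unfolding decseq_def
    proof (intro allI impI subsetI)
      fix m n z assume mn: "m \<le> n" and z: "z \<in> layer (e n) S"
      have "cball z (e n) \<subseteq> cball z (e m)" using e(2) mn by (simp add: decseq_def subset_cball)
      then show "z \<in> layer (e m) S" using z unfolding layer_def by blast
    qed
    have "layer (e n) S \<subseteq> S" for n by (auto simp: layer_def)
    then have "bounded (layer (e n) S)" for n using S by (meson bounded_subset compact_imp_bounded)
    then show "emeasure lborel (layer (e n) S) \<noteq> \<infinity>" for n
      using emeasure_bounded_finite by (metis infinity_ennreal_def less_irrefl)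
  qed
  ultimately show ?thesis by simp
qed

section \<open>Pair sums\<close>

definition pair_sum :: "('a::ab_group_add \<Rightarrow> 'b::comm_monoid_add) \<Rightarrow> 'a set \<Rightarrow> 'b" where
  "pair_sum f X = (\<Sum>x\<in>X. \<Sum>y\<in>X. f (x - y))"

lemma scale_measure_eq_density: "scale_measure c M = density M (\<lambda>_. c)"
  by (rule measure_eqI) (simp_all add: emeasure_density nn_integral_cmult_indicator)

lemma integral_finite_autocorrelation:
  fixes f :: "'a::euclidean_space \<Rightarrow> real"
  assumes fin: "finite (\<Lambda> \<inter> cball 0 r)" and f: "f \<in> borel_measurable borel"
  shows "(\<integral>z. f z \<partial>finite_autocorrelation \<Lambda> r) =
    pair_sum f (\<Lambda> \<inter> cball 0 r) / measure lborel (cball 0 r :: 'a set)"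
proof -
  let ?X = "\<Lambda> \<inter> cball 0 r"
  let ?M = "distr (count_space (?X \<times> ?X)) borel (\<lambda>(x, y). x - y)"
  have "(\<integral>z. f z \<partial>finite_autocorrelation \<Lambda> r) =
      (\<integral>z. (1 / measure lborel (cball 0 r :: 'a set)) *\<^sub>R f z \<partial>?M)"
    unfolding finite_autocorrelation_def scale_measure_eq_density
    by (rule integral_density) (use f in auto)
  also have "\<dots> = (1 / measure lborel (cball 0 r :: 'a set)) * (\<integral>z. f z \<partial>?M)" by simp
  also have "(\<integral>z. f z \<partial>?M) = (\<integral>z. f (case z of (x, y) \<Rightarrow> x - y) \<partial>count_space (?X \<times> ?X))"
    using f by (intro integral_distr) auto
  also have "\<dots> = pair_sum f ?X"
    using fin
    by (simp add: lebesgue_integral_count_space_finite pair_sum_def sum.cartesian_product case_prod_unfold)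
  finally show ?thesis by simp
qed

text \<open>The limit over all radii passes to whichever sequence of radii produced \<gamma>. Vague
  convergence is tested with real functions, hence the detour through real and imaginary
  parts.\<close>

lemma autocorrelation_integral_eq_0:
  fixes F :: "'a::euclidean_space \<Rightarrow> complex"
  assumes ac: "autocorrelation \<Lambda> \<gamma>" and fin: "\<And>r. finite (\<Lambda> \<inter> cball 0 r)"
    and F: "continuous_on UNIV F" "\<And>z. norm z > \<rho> \<Longrightarrow> F z = 0"
    and int: "integrable \<gamma> F"
    and lim: "((\<lambda>r. pair_sum F (\<Lambda> \<inter> cball 0 r) / measure lborel (cball 0 r :: 'a set)) \<longlongrightarrow> 0) at_top"
  shows "(\<integral>z. F z \<partial>\<gamma>) = 0"
proof -
  obtain r where r: "filterlim r at_top sequentially"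
    and vl: "vague_limit (\<lambda>n. finite_autocorrelation \<Lambda> (r n)) \<gamma>"
    using ac unfolding autocorrelation_def by blast
  have lim_r: "(\<lambda>n. pair_sum F (\<Lambda> \<inter> cball 0 (r n)) / measure lborel (cball 0 (r n) :: 'a set)) \<longlonglongrightarrow> 0"
    by (rule filterlim_compose[OF lim r])
  have comp: "compact (closure {z. f z \<noteq> (0::real)})" if "\<And>z. norm z > \<rho> \<Longrightarrow> f z = 0" for f :: "'a \<Rightarrow> real"
  proof -
    have "{z. f z \<noteq> 0} \<subseteq> cball 0 \<rho>" using that by (force simp: not_less[symmetric])
    then show ?thesis using bounded_subset bounded_cball compact_closure by blast
  qed
  have part: "(\<integral>z. g (F z) \<partial>\<gamma>) = 0"
    if g: "bounded_linear g" for g :: "complex \<Rightarrow> real"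
  proof -
    interpret bounded_linear g by fact
    have cont: "continuous_on UNIV (\<lambda>z. g (F z))" by (rule continuous_on[OF F(1)])
    have "(\<lambda>n. \<integral>z. g (F z) \<partial>finite_autocorrelation \<Lambda> (r n)) \<longlonglongrightarrow> (\<integral>z. g (F z) \<partial>\<gamma>)"
      using vl cont comp[of "\<lambda>z. g (F z)"] F(2) zero unfolding vague_limit_def by simp
    moreover have "(\<integral>z. g (F z) \<partial>finite_autocorrelation \<Lambda> (r n)) =
        g (pair_sum F (\<Lambda> \<inter> cball 0 (r n)) / measure lborel (cball 0 (r n) :: 'a set))" for n
    proof -
      have "g (z / complex_of_real c) = g z / c" for z c
        using scaleR[of "1 / c" z] by (simp add: scaleR_conv_of_real divide_inverse mult.commute)
      then show ?thesis
        using cont by (subst integral_finite_autocorrelation[OF fin])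
          (simp_all add: borel_measurable_continuous_onI pair_sum_def sum)
    qed
    moreover have "(\<lambda>n. g (pair_sum F (\<Lambda> \<inter> cball 0 (r n)) / measure lborel (cball 0 (r n) :: 'a set))) \<longlonglongrightarrow> g 0"
      by (rule tendsto[OF lim_r])
    ultimately show ?thesis using LIMSEQ_unique zero by fastforce
  qed
  have "Re (\<integral>z. F z \<partial>\<gamma>) = 0" "Im (\<integral>z. F z \<partial>\<gamma>) = 0"
    using part[OF bounded_linear_Re] part[OF bounded_linear_Im] int by simp_all
  then show ?thesis by (simp add: complex_eq_iff)
qed

lemma pair_sum_similarity:
  fixes F :: "complex \<Rightarrow> complex"
  assumes "cmod u = 1" "\<And>z. F (u * z) = u ^ m * F z"
  shows "pair_sum F ((\<lambda>z. u * z + v) ` X) = u ^ m * pair_sum F X"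
proof -
  have "u \<noteq> 0" using assms(1) by auto
  then have inj: "inj_on (\<lambda>z. u * z + v) X" by (auto simp: inj_on_def)
  have "F (u * x + v - (u * y + v)) = u ^ m * F (x - y)" for x y
    using assms(2)[of "x - y"] by (simp add: right_diff_distrib)
  then show ?thesis
    by (simp add: pair_sum_def sum.reindex[OF inj] sum_distrib_left)
qed

section \<open>Kernels of bounded range\<close>

locale pair_kernel =
  fixes F :: "complex \<Rightarrow> complex" and \<rho> B :: real
  assumes supp: "\<And>z. cmod z > \<rho> \<Longrightarrow> F z = 0" and bound: "\<And>z. cmod (F z) \<le> B"
begin

lemma B_nonneg: "0 \<le> B"
  using bound[of 0] norm_ge_zero order_trans by blast

lemma row_sum_bound:
  assumes fin: "finite X" and D: "card (X \<inter> cball x \<rho>) \<le> D"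
  shows "cmod (\<Sum>y\<in>X. F (x - y)) \<le> B * D"
proof -
  have "(\<Sum>y\<in>X. F (x - y)) = (\<Sum>y\<in>X \<inter> cball x \<rho>. F (x - y))"
    using fin supp by (intro sum.mono_neutral_right) (auto simp: dist_norm not_le)
  also have "cmod \<dots> \<le> (\<Sum>y\<in>X \<inter> cball x \<rho>. B)" by (intro sum_norm_le bound)
  also have "\<dots> \<le> B * D" using D B_nonneg by (simp add: mult.commute mult_left_mono)
  finally show ?thesis .
qed

lemma partial_pair_sum_bound:
  assumes "finite Y" "finite X" and D: "\<And>x. card (X \<inter> cball x \<rho>) \<le> D"
  shows "cmod (\<Sum>x\<in>Y. \<Sum>y\<in>X. F (x - y)) \<le> card Y * (B * D)"
  using sum_norm_le[of Y "\<lambda>x. \<Sum>y\<in>X. F (x - y)" "\<lambda>_. B * D"] row_sum_bound[OF assms(2) D]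
  by simp

text \<open>A lost pair has its first or its second entry in \<open>X - Y\<close>, hence the factor
  2.\<close>

lemma pair_sum_subset:
  assumes fin: "finite X" and D: "\<And>x. card (X \<inter> cball x \<rho>) \<le> D" and Y: "Y \<subseteq> X"
  shows "cmod (pair_sum F X - pair_sum F Y) \<le> 2 * card (X - Y) * (B * D)"
proof -
  have finY: "finite Y" using fin Y finite_subset by blast
  let ?g = "\<lambda>X x. \<Sum>y\<in>X. F (x - y)"
  have 1: "cmod (\<Sum>x\<in>X - Y. ?g X x) \<le> card (X - Y) * (B * D)"
    using partial_pair_sum_bound[OF _ fin D] fin by blast
  have DY: "card (Y \<inter> cball y \<rho>) \<le> D" for y
    using card_mono[of "X \<inter> cball y \<rho>" "Y \<inter> cball y \<rho>"] fin Y D[of y] by fastforce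
  have swap: "(\<Sum>x\<in>Y. \<Sum>y\<in>X - Y. F (x - y)) = (\<Sum>y\<in>X - Y. \<Sum>x\<in>Y. F (x - y))"
    by (rule sum.swap)
  have col: "cmod (\<Sum>x\<in>Y. F (x - y)) \<le> B * D" for y
  proof -
    \<comment> \<open>Column sums of \<open>F\<close> are row sums of the reflected kernel.\<close>
    interpret R: pair_kernel "\<lambda>z. F (- z)" \<rho> B by unfold_locales (auto simp: supp bound)
    show ?thesis using R.row_sum_bound[OF finY DY, of y] by simp
  qed
  have 2: "cmod (\<Sum>x\<in>Y. \<Sum>y\<in>X - Y. F (x - y)) \<le> card (X - Y) * (B * D)"
    unfolding swap using sum_norm_le[of "X - Y" "\<lambda>y. \<Sum>x\<in>Y. F (x - y)" "\<lambda>_. B * D"] col by simp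
  have row: "?g X x = ?g (X - Y) x + ?g Y x" for x
    using sum.subset_diff[OF Y fin, of "\<lambda>y. F (x - y)"] .
  have "pair_sum F X = (\<Sum>x\<in>X - Y. ?g X x) + (\<Sum>x\<in>Y. ?g X x)"
    unfolding pair_sum_def by (rule sum.subset_diff[OF Y fin])
  also have "(\<Sum>x\<in>Y. ?g X x) = (\<Sum>x\<in>Y. ?g (X - Y) x) + pair_sum F Y"
    by (simp add: sum.distrib pair_sum_def row)
  finally have "pair_sum F X - pair_sum F Y = (\<Sum>x\<in>X - Y. ?g X x) + (\<Sum>x\<in>Y. ?g (X - Y) x)" by simp
  then show ?thesis using 1 2 norm_triangle_mono[OF 1 2] by (simp add: algebra_simps)
qed

text \<open>A point at distance more than \<rho> from the outside of its region \<open>Z a\<close>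
  interacts only with points of \<open>X a\<close>. Every other point is charged twice, once for its
  row in the union and once for its row in its own piece.\<close>

lemma pair_sum_decomposition:
  fixes Z :: "'c \<Rightarrow> complex set"
  defines "Y \<equiv> \<lambda>X a. {x \<in> X a. \<not> cball x \<rho> \<subseteq> interior (Z a)}"
  assumes \<rho>: "\<rho> \<ge> 0" and A: "finite A" and X: "\<And>a. a \<in> A \<Longrightarrow> finite (X a)" "\<And>a. a \<in> A \<Longrightarrow> X a \<subseteq> Z a"
    and Z: "\<And>a b. a \<in> A \<Longrightarrow> b \<in> A \<Longrightarrow> a \<noteq> b \<Longrightarrow> interior (Z a) \<inter> Z b = {}"
    and D: "\<And>x. card ((\<Union>a\<in>A. X a) \<inter> cball x \<rho>) \<le> D"
  shows "cmod (pair_sum F (\<Union>a\<in>A. X a) - (\<Sum>a\<in>A. pair_sum F (X a))) \<le>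
    2 * (B * D) * (\<Sum>a\<in>A. card (Y X a))"
proof -
  let ?U = "\<Union>a\<in>A. X a" and ?g = "\<lambda>X x. \<Sum>y\<in>X. F (x - y)"
  let ?G = "\<lambda>a. X a - Y X a"
  have finU: "finite ?U" using A X(1) by auto
  have finY: "finite (Y X a)" if "a \<in> A" for a using X(1)[OF that] by (simp add: Y_def)
  have in_int: "x \<in> interior (Z a)" if "x \<in> ?G a" for x a
    using that \<rho> unfolding Y_def by (metis (mono_tags, lifting) DiffD1 DiffD2 centre_in_cball mem_Collect_eq subsetD)
  have row: "?g ?U x = ?g (X a) x" if a: "a \<in> A" and x: "x \<in> ?G a" for a x
  proof (rule sum.mono_neutral_right[OF finU])
    show "X a \<subseteq> ?U" using a by blast
    show "\<forall>y\<in>?U - X a. F (x - y) = 0"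
    proof
      fix y assume "y \<in> ?U - X a"
      then obtain b where b: "b \<in> A" "y \<in> X b" "b \<noteq> a" by blast
      then have "y \<notin> interior (Z a)" using Z[OF a b(1)] X(2)[OF b(1)] by blast
      then have "y \<notin> cball x \<rho>" using x unfolding Y_def by blast
      then show "F (x - y) = 0" by (intro supp) (simp add: dist_norm)
    qed
  qed
  \<comment> \<open>The sets \<open>X a\<close> themselves may meet, since neighbouring tiles can
    share a control point on their common boundary; their inner parts cannot.\<close>
  have disj: "?G a \<inter> ?G b = {}" if "a \<in> A" "b \<in> A" "a \<noteq> b" for a b
    using Z[OF that] in_int[of _ a] X(2)[OF that(2)] by blast
  have "pair_sum F ?U = (\<Sum>x\<in>?U - (\<Union>a\<in>A. ?G a). ?g ?U x) + (\<Sum>x\<in>(\<Union>a\<in>A. ?G a). ?g ?U x)"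
    unfolding pair_sum_def by (rule sum.subset_diff[OF _ finU]) blast
  also have "(\<Sum>x\<in>(\<Union>a\<in>A. ?G a). ?g ?U x) = (\<Sum>a\<in>A. \<Sum>x\<in>?G a. ?g ?U x)"
    by (rule sum.UNION_disjoint) (use A X(1) disj in auto)
  also have "\<dots> = (\<Sum>a\<in>A. \<Sum>x\<in>?G a. ?g (X a) x)"
    by (intro sum.cong refl row)
  also have "\<dots> = (\<Sum>a\<in>A. pair_sum F (X a) - (\<Sum>x\<in>Y X a. ?g (X a) x))"
  proof (rule sum.cong[OF refl])
    fix a assume a: "a \<in> A"
    have "pair_sum F (X a) = (\<Sum>x\<in>?G a. ?g (X a) x) + (\<Sum>x\<in>Y X a. ?g (X a) x)"
      unfolding pair_sum_def by (rule sum.subset_diff[OF _ X(1)[OF a]]) (auto simp: Y_def)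
    then show "(\<Sum>x\<in>?G a. ?g (X a) x) = pair_sum F (X a) - (\<Sum>x\<in>Y X a. ?g (X a) x)" by simp
  qed
  also have "\<dots> = (\<Sum>a\<in>A. pair_sum F (X a)) - (\<Sum>a\<in>A. \<Sum>x\<in>Y X a. ?g (X a) x)"
    by (rule sum_subtractf)
  finally have eq: "pair_sum F ?U - (\<Sum>a\<in>A. pair_sum F (X a)) =
      (\<Sum>x\<in>?U - (\<Union>a\<in>A. ?G a). ?g ?U x) - (\<Sum>a\<in>A. \<Sum>x\<in>Y X a. ?g (X a) x)" by simp
  have BD: "0 \<le> B * D" using B_nonneg by simp
  have "card (?U - (\<Union>a\<in>A. ?G a)) \<le> card (\<Union>a\<in>A. Y X a)"
    by (rule card_mono) (use A finY in auto)
  also have "\<dots> \<le> (\<Sum>a\<in>A. card (Y X a))" by (rule card_UN_le[OF A])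
  finally have c: "real (card (?U - (\<Union>a\<in>A. ?G a))) \<le> (\<Sum>a\<in>A. card (Y X a))" by (metis of_nat_mono)
  have "cmod (\<Sum>x\<in>?U - (\<Union>a\<in>A. ?G a). ?g ?U x) \<le> card (?U - (\<Union>a\<in>A. ?G a)) * (B * D)"
    using finU D by (intro partial_pair_sum_bound) auto
  also have "\<dots> \<le> (\<Sum>a\<in>A. card (Y X a)) * (B * D)" by (rule mult_right_mono[OF c BD])
  finally have 1: "cmod (\<Sum>x\<in>?U - (\<Union>a\<in>A. ?G a). ?g ?U x) \<le> (\<Sum>a\<in>A. card (Y X a)) * (B * D)" .
  have "cmod (\<Sum>a\<in>A. \<Sum>x\<in>Y X a. ?g (X a) x) \<le> (\<Sum>a\<in>A. card (Y X a) * (B * D))"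
  proof (rule sum_norm_le)
    fix a assume a: "a \<in> A"
    have "card (X a \<inter> cball x \<rho>) \<le> D" for x
      using card_mono[of "?U \<inter> cball x \<rho>" "X a \<inter> cball x \<rho>"] finU a D[of x] by fastforce
    then show "cmod (\<Sum>x\<in>Y X a. ?g (X a) x) \<le> card (Y X a) * (B * D)"
      using finY[OF a] X(1)[OF a] by (intro partial_pair_sum_bound)
  qed
  also have "\<dots> = (\<Sum>a\<in>A. card (Y X a)) * (B * D)" by (simp add: sum_distrib_right)
  finally have 2: "cmod (\<Sum>a\<in>A. \<Sum>x\<in>Y X a. ?g (X a) x) \<le> (\<Sum>a\<in>A. card (Y X a)) * (B * D)" .
  show ?thesis unfolding eq
    using norm_triangle_ineq4[of "\<Sum>x\<in>?U - (\<Union>a\<in>A. ?G a). ?g ?U x" "\<Sum>a\<in>A. \<Sum>x\<in>Y X a. ?g (X a) x"] 1 2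
    by (simp add: algebra_simps)
qed

end

section \<open>Supertiles\<close>

locale self_similar_substitution =
  fixes P :: "'i::finite \<Rightarrow> complex set" and l :: real
    and \<sigma> :: "'i \<Rightarrow> 'i tile set" and x :: "'i \<Rightarrow> complex"
  assumes prototiles_P: "prototiles P" and substitution_\<sigma>: "substitution P l \<sigma>"
    and control_point: "\<And>i. x i \<in> P i"
begin

text \<open>Interiors are measured because they are disjoint for distinct tiles, whatever the size
  of the boundaries, which are shown to be null only later.\<close>

definition area :: "'i \<Rightarrow> real" where
  "area i = measure lborel (interior (P i))"

definition min_area :: real where
  "min_area = Min (range area)"

definition diam :: real where
  "diam = diameter (\<Union>i. P i)"

definition point :: "'i tile \<Rightarrow> complex" where
  "point S = place S (x (proto S))"

text \<open>The region covered by the k-th order supertile grown from \<open>T\<close>; see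
  \<open>support_iter\<close>.\<close>

definition inflated :: "nat \<Rightarrow> 'i tile \<Rightarrow> complex set" where
  "inflated k T = (\<lambda>z. l ^ k *\<^sub>R z) ` support P T"

abbreviation iter :: "nat \<Rightarrow> 'i tile set \<Rightarrow> 'i tile set" where
  "iter k F \<equiv> (subst l \<sigma> ^^ k) F"

abbreviation super :: "nat \<Rightarrow> 'i \<Rightarrow> 'i tile set" where
  "super k i \<equiv> supertile l \<sigma> k i"

lemma l_gt_1: "l > 1"
  using substitution_\<sigma> by (simp add: substitution_def)

lemma l_power_pos: "l ^ k > 0"
  using l_gt_1 by simp

lemma compact_P: "compact (P i)" and closure_interior_P: "closure (interior (P i)) = P i"
  using prototiles_P by (auto simp: prototiles_def)

lemma emeasure_P_finite: "A \<subseteq> P i \<Longrightarrow> emeasure lborel A < \<infinity>"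
  by (meson bounded_subset compact_P compact_imp_bounded emeasure_bounded_finite)

lemma area_pos: "area i > 0"
proof -
  have "interior (P i) \<noteq> {}" using closure_interior_P[of i] control_point[of i] by force
  then obtain z e where "e > 0" "ball z e \<subseteq> interior (P i)"
    using open_interior open_contains_ball by (metis ex_in_conv)
  then have "measure lborel (ball z e) \<le> measure lborel (interior (P i))"
    using emeasure_P_finite[OF interior_subset, of i]
    by (intro measure_mono_fmeasurable) (auto simp: fmeasurable_def)
  moreover have "measure lborel (ball z e) > 0" using content_ball_pos[OF \<open>e > 0\<close>, of z] by simp
  ultimately show ?thesis unfolding area_def by linarith
qed

lemma min_area_pos: "min_area > 0" and min_area_le: "min_area \<le> area i"
proof -
  have "min_area \<in> range area" unfolding min_area_def by (intro Min_in) auto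
  then show "min_area > 0" using area_pos by auto
  show "min_area \<le> area i" unfolding min_area_def by (intro Min_le) auto
qed

lemma inflated_similarity:
  "inflated k T = (\<lambda>z. (l ^ k * rot T) * z + l ^ k * shift T) ` P (proto T)"
  by (simp add: inflated_def support_similarity image_image scaleR_conv_of_real algebra_simps)

lemma inflated_0: "inflated 0 T = support P T"
  by (simp add: inflated_def)

lemma rot_nonzero: "T \<in> tiles \<Longrightarrow> rot T \<noteq> 0"
  by (auto simp: tiles_def)

lemma scale_rot:
  assumes "T \<in> tiles"
  shows "complex_of_real l ^ k * rot T \<noteq> 0" "cmod (complex_of_real l ^ k * rot T) = l ^ k"
  using assms l_gt_1 by (auto simp: tiles_def norm_mult norm_power)

lemma compact_inflated: "compact (inflated k T)"
  unfolding inflated_similarity by (intro compact_continuous_image continuous_intros compact_P)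

lemma interior_inflated:
  assumes "T \<in> tiles"
  shows "interior (inflated k T) = (\<lambda>z. (l ^ k * rot T) * z + l ^ k * shift T) ` interior (P (proto T))"
  using scale_rot[OF assms, of k] unfolding inflated_similarity
  by (subst interior_similarity) simp_all

lemma closure_interior_inflated:
  assumes "T \<in> tiles"
  shows "closure (interior (inflated k T)) = inflated k T"
  unfolding interior_inflated[OF assms] unfolding inflated_similarity
  using closure_similarity[OF scale_rot(1)[OF assms, of k]] by (simp add: closure_interior_P)

lemma measure_interior_inflated:
  "T \<in> tiles \<Longrightarrow> measure lborel (interior (inflated k T)) = l ^ (2 * k) * area (proto T)"
  using scale_rot[of T k]
  by (simp add: interior_inflated measure_similarity area_def power_mult mult.commute[of 2])

lemma layer_inflated:
  assumes "T \<in> tiles"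
  shows "measure lborel (layer e (inflated k T)) = l ^ (2 * k) * measure lborel (layer (e / l ^ k) (P (proto T)))"
proof -
  have "layer (l ^ k * (e / l ^ k)) (inflated k T) =
      (\<lambda>z. (l ^ k * rot T) * z + l ^ k * shift T) ` layer (e / l ^ k) (P (proto T))"
    using layer_similarity[of "l ^ k * rot T" "e / l ^ k" "l ^ k * shift T" "P (proto T)"] scale_rot[OF assms, of k]
    by (simp add: inflated_similarity)
  then have "layer e (inflated k T) =
      (\<lambda>z. (l ^ k * rot T) * z + l ^ k * shift T) ` layer (e / l ^ k) (P (proto T))"
    using l_gt_1 by simp
  moreover have "layer (e / l ^ k) (P (proto T)) \<in> sets borel"
    by (simp add: closed_layer compact_imp_closed compact_P)
  ultimately show ?thesis
    using scale_rot[OF assms, of k]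
    by (simp add: measure_similarity power_mult mult.commute[of 2])
qed

lemma diam_nonneg: "0 \<le> diam"
  unfolding diam_def by (intro diameter_ge_0 bounded_UN) (auto simp: compact_P compact_imp_bounded)

lemma dist_inflated:
  assumes "T \<in> tiles" "y \<in> inflated k T" "z \<in> inflated k T"
  shows "dist y z \<le> l ^ k * diam"
proof -
  obtain y' z' where y': "y' \<in> P (proto T)" "y = (l ^ k * rot T) * y' + l ^ k * shift T"
    and z': "z' \<in> P (proto T)" "z = (l ^ k * rot T) * z' + l ^ k * shift T"
    using assms unfolding inflated_similarity by blast
  have "bounded (\<Union>i. P i)" by (intro bounded_UN) (auto simp: compact_P compact_imp_bounded)
  then have "dist y' z' \<le> diam" unfolding diam_def
    by (rule diameter_bounded_bound) (use y' z' in auto)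
  moreover have "dist y z = l ^ k * dist y' z'"
    using scale_rot(2)[OF assms(1), of k]
    by (simp add: y' z' dist_norm flip: norm_mult right_diff_distrib) (simp add: norm_mult)
  ultimately show ?thesis using l_power_pos by simp
qed

lemma point_in_support: "point T \<in> support P T"
  by (simp add: point_def support_def control_point)

lemma point_move: "point (move u v T) = u * point T + v"
  by (simp add: point_def)

text \<open>An open set that misses another open set also misses its closure, and an inflated tile
  is the closure of its interior. This asymmetric form is what the decomposition of pair sums
  requires.\<close>

lemma interior_inflated_disjoint:
  assumes "F \<subseteq> tiles" "non_overlapping P F" "S \<in> F" "T \<in> F" "S \<noteq> T"
  shows "interior (inflated k S) \<inter> inflated k T = {}"
proof -
  have eq: "interior (inflated k W) = (\<lambda>z. l ^ k *\<^sub>R z) ` interior (support P W)" for W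
    unfolding inflated_def using l_gt_1
    by (intro interior_injective_linear_image) (auto simp: inj_def linear_scale_self)
  have "interior (support P S) \<inter> interior (support P T) = {}"
    using assms by (auto simp: non_overlapping_def pairwise_def disjnt_def)
  then have "interior (inflated k S) \<inter> interior (inflated k T) = {}"
    using l_gt_1 by (auto simp: eq)
  then have "interior (inflated k S) \<inter> closure (interior (inflated k T)) = {}"
    by (simp add: open_Int_closure_eq_empty)
  then show ?thesis using assms by (simp add: closure_interior_inflated subsetD)
qed

lemma sum_area_le:
  assumes "finite F" "F \<subseteq> tiles" "non_overlapping P F"
    and sub: "\<And>T. T \<in> F \<Longrightarrow> interior (inflated k T) \<subseteq> Z" and Z: "Z \<in> fmeasurable lborel"
  shows "l ^ (2 * k) * (\<Sum>T\<in>F. area (proto T)) \<le> measure lborel Z"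
proof -
  have fm: "interior (inflated k T) \<in> fmeasurable lborel" for T
  proof -
    have "emeasure lborel (interior (inflated k T)) < \<infinity>"
      by (meson bounded_subset compact_imp_bounded compact_inflated emeasure_bounded_finite interior_subset)
    then show ?thesis by (simp add: fmeasurable_def)
  qed
  have "l ^ (2 * k) * (\<Sum>T\<in>F. area (proto T)) = (\<Sum>T\<in>F. measure lborel (interior (inflated k T)))"
    using assms(2) by (simp add: sum_distrib_left measure_interior_inflated subsetD)
  also have "\<dots> = measure lborel (\<Union>T\<in>F. interior (inflated k T))"
  proof (rule measure_UNION'[symmetric])
    show "pairwise (\<lambda>i j. disjnt (interior (inflated k i)) (interior (inflated k j))) F"
    proof (rule pairwiseI)
      fix S T assume "S \<in> F" "T \<in> F" "S \<noteq> T"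
      then show "disjnt (interior (inflated k S)) (interior (inflated k T))"
        using interior_inflated_disjoint[OF assms(2,3), of S T k] interior_subset[of "inflated k T"]
        unfolding disjnt_def by blast
    qed
  qed (use assms(1) fm in auto)
  also have "\<dots> \<le> measure lborel Z"
    using Z sub assms(1) fm by (intro measure_mono_fmeasurable sets.finite_UN) auto
  finally show ?thesis .
qed

text \<open>Every tile occupies at least \<open>min_area\<close> of \<open>Z\<close>. Finiteness
  comes out as well, since arbitrarily large finite subfamilies would exceed the area
  available.\<close>

lemma card_le:
  assumes "F \<subseteq> tiles" "non_overlapping P F"
    and sub: "\<And>T. T \<in> F \<Longrightarrow> support P T \<subseteq> Z" and Z: "Z \<in> fmeasurable lborel"
  shows "finite F" "card F * min_area \<le> measure lborel Z"
proof -
  have bound: "card G * min_area \<le> measure lborel Z" if "G \<subseteq> F" "finite G" for G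
  proof -
    have "card G * min_area \<le> (\<Sum>T\<in>G. area (proto T))"
      using sum_bounded_below[of G min_area "\<lambda>T. area (proto T)"] min_area_le by simp
    also have "\<dots> = l ^ (2 * 0) * (\<Sum>T\<in>G. area (proto T))" by simp
    also have "\<dots> \<le> measure lborel Z"
    proof (rule sum_area_le[OF \<open>finite G\<close> _ _ _ Z])
      show "G \<subseteq> tiles" "non_overlapping P G"
        using that(1) assms(1,2) non_overlapping_subset by blast+
      show "interior (inflated 0 T) \<subseteq> Z" if "T \<in> G" for T
        using that \<open>G \<subseteq> F\<close> sub[of T] interior_subset[of "support P T"] by (auto simp: inflated_0)
    qed
    finally show ?thesis .
  qed
  show "finite F"
  proof (rule ccontr)
    assume "infinite F"
    obtain n :: nat where n: "n * min_area > measure lborel Z"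
      using min_area_pos reals_Archimedean3 by blast
    obtain G where "G \<subseteq> F" "finite G" "card G = n"
      using infinite_arbitrarily_large[OF \<open>infinite F\<close>] by blast
    then show False using bound[of G] n by simp
  qed
  then show "card F * min_area \<le> measure lborel Z" using bound by blast
qed

lemma subst_tiles:
  assumes "F \<subseteq> tiles"
  shows "subst l \<sigma> F \<subseteq> tiles"
proof -
  have "\<sigma> i \<subseteq> tiles" for i using substitution_\<sigma> by (simp add: substitution_def)
  then show ?thesis
    using assms by (auto simp: subst_def subst_tile_def tiles_def norm_mult subset_iff)
qed

lemma finite_subst: "finite F \<Longrightarrow> finite (subst l \<sigma> F)"
  using substitution_\<sigma> by (auto simp: subst_def subst_tile_def substitution_def)

lemma support_subst_tile: "(\<Union>S\<in>subst_tile l \<sigma> T. support P S) = inflated 1 T"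
proof -
  have \<sigma>: "(\<Union>S\<in>\<sigma> i. support P S) = (\<lambda>z. l *\<^sub>R z) ` P i" for i
    using substitution_\<sigma> by (simp add: substitution_def)
  have "(\<Union>S\<in>subst_tile l \<sigma> T. support P S) =
      (\<lambda>z. rot T * z + l *\<^sub>R shift T) ` (\<Union>S\<in>\<sigma> (proto T). support P S)"
    by (auto simp: subst_tile_def support_move)
  also have "\<dots> = inflated 1 T"
    unfolding \<sigma> by (simp add: inflated_similarity image_image scaleR_conv_of_real mult.assoc mult.left_commute)
  finally show ?thesis .
qed

lemma support_iter: "(\<Union>S\<in>iter k F. support P S) = (\<Union>T\<in>F. inflated k T)"
proof (induction k)
  case (Suc k)
  have "(\<Union>S\<in>iter (Suc k) F. support P S) = (\<Union>T\<in>iter k F. inflated 1 T)"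
    by (simp add: subst_def support_subst_tile)
  also have "\<dots> = (\<lambda>z. l *\<^sub>R z) ` (\<Union>T\<in>iter k F. support P T)"
    by (simp add: inflated_def image_UN)
  also have "\<dots> = (\<Union>T\<in>F. inflated (Suc k) T)"
    unfolding Suc by (simp add: inflated_def image_UN image_image)
  finally show ?case .
qed (simp add: inflated_0)

lemma non_overlapping_subst:
  assumes F: "F \<subseteq> tiles" "non_overlapping P F"
  shows "non_overlapping P (subst l \<sigma> F)"
  unfolding non_overlapping_def
proof (rule pairwiseI)
  fix S S' assume S: "S \<in> subst l \<sigma> F" "S' \<in> subst l \<sigma> F" "S \<noteq> S'"
  then obtain T T' where T: "T \<in> F" "S \<in> subst_tile l \<sigma> T" "T' \<in> F" "S' \<in> subst_tile l \<sigma> T'"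
    by (auto simp: subst_def)
  show "disjnt (interior (support P S)) (interior (support P S'))"
  proof (cases "T = T'")
    case True
    have "non_overlapping P (subst_tile l \<sigma> T)"
      unfolding subst_tile_def
      using F(1) T(1) substitution_\<sigma> by (intro non_overlapping_move) (auto simp: tiles_def substitution_def)
    then show ?thesis using True T S by (simp add: non_overlapping_def pairwise_def)
  next
    case False
    have "interior (support P S) \<subseteq> interior (inflated 1 T)" "interior (support P S') \<subseteq> interior (inflated 1 T')"
      using T support_subst_tile by (blast intro!: interior_mono)+
    then show ?thesis
      using interior_inflated_disjoint[OF F T(1,3) False, of 1] interior_subset
      unfolding disjnt_def by blast
  qed
qed

lemma iter_tiles: "F \<subseteq> tiles \<Longrightarrow> iter k F \<subseteq> tiles"
  by (induction k) (simp_all add: subst_tiles)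

lemma finite_iter: "finite F \<Longrightarrow> finite (iter k F)"
  by (induction k) (simp_all add: finite_subst)

lemma non_overlapping_iter: "F \<subseteq> tiles \<Longrightarrow> non_overlapping P F \<Longrightarrow> non_overlapping P (iter k F)"
  by (induction k) (simp_all add: non_overlapping_subst iter_tiles)

lemma super_tiles: "super k i \<subseteq> tiles"
  unfolding supertile_def by (rule iter_tiles) (simp add: tiles_def)

lemma finite_super: "finite (super k i)"
  unfolding supertile_def by (rule finite_iter) simp

lemma non_overlapping_super: "non_overlapping P (super k i)"
  unfolding supertile_def
  by (rule non_overlapping_iter) (simp_all add: tiles_def non_overlapping_def)

lemma support_super: "(\<Union>S\<in>super k i. support P S) = inflated k (Tile i 1 0)"
  by (simp add: supertile_def support_iter)

text \<open>This makes the areas admissible weights for the recursion. As an inequality between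
  interior areas it does not presuppose null boundaries and can serve in proving them null.\<close>

lemma sum_area_super: "(\<Sum>T\<in>super k i. area (proto T)) \<le> l ^ (2 * k) * area i"
proof -
  let ?T = "Tile i 1 0 :: 'i tile"
  have T: "?T \<in> tiles" by (simp add: tiles_def)
  have "interior (inflated k ?T) \<in> fmeasurable lborel"
    using emeasure_bounded_finite compact_imp_bounded[OF compact_inflated]
    by (metis bounded_interior borel_open fmeasurableI infinity_ennreal_def open_interior sets_lborel)
  moreover have "interior (inflated 0 S) \<subseteq> interior (inflated k ?T)" if "S \<in> super k i" for S
    using that support_super[of k i] by (intro interior_mono) (auto simp: inflated_0)
  ultimately show ?thesis
    using sum_area_le[OF finite_super super_tiles non_overlapping_super, of k i 0 "interior (inflated k ?T)"]
      measure_interior_inflated[OF T, of k] by simp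
qed

text \<open>
  Otherwise choose a type with the largest ratio of boundary to interior area. The boundary of a
  large supertile of this type is covered by the boundaries of its tiles, but the tiles in
  its interior do not contribute.
\<close>

lemma boundary_null: "measure lborel (P i - interior (P i)) = 0"
proof -
  define e where "e i = measure lborel (P i - interior (P i))" for i
  have e0: "e i \<ge> 0" for i by (simp add: e_def)
  have bd: "measure lborel (inflated k T - interior (inflated k T)) = l ^ (2 * k) * e (proto T)"
    if T: "T \<in> tiles" for k T
  proof -
    have "inflated k T - interior (inflated k T) =
        (\<lambda>z. (l ^ k * rot T) * z + l ^ k * shift T) ` (P (proto T) - interior (P (proto T)))"
      unfolding interior_inflated[OF T] unfolding inflated_similarity
      by (rule image_set_diff[symmetric], rule inj_similarity) (use scale_rot(1)[OF T, of k] in simp)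
    then show ?thesis
      using scale_rot[OF T, of k] borel_compact[OF compact_P]
      by (simp add: measure_similarity e_def power_mult mult.commute[of 2])
  qed
  define c where "c = Max (range (\<lambda>i. e i / area i))"
  have c_ge: "e i \<le> c * area i" for i
  proof -
    have "e i / area i \<le> c" unfolding c_def by (intro Max_ge) auto
    then show ?thesis using area_pos[of i] by (simp add: field_simps)
  qed
  have "c \<in> range (\<lambda>i. e i / area i)" unfolding c_def by (intro Max_in) auto
  then obtain j where "c = e j / area j" by blast
  then have j: "e j = c * area j" using area_pos[of j] by simp
  have "c \<le> 0"
  proof (rule ccontr)
    assume "\<not> c \<le> 0"
    then have c: "c > 0" by simp
    have "interior (P j) \<noteq> {}" using closure_interior_P[of j] control_point[of j] by force
    then obtain z d where d: "d > 0" "ball z d \<subseteq> interior (P j)"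
      using open_interior open_contains_ball by (metis ex_in_conv)
    \<comment> \<open>After inflation the ball has radius l^k * d > diam, so a tile that contains
      its centre \<open>?w\<close> lies entirely inside it.\<close>
    obtain k where k: "diam / d < l ^ k" using real_arch_pow[OF l_gt_1] by blast
    let ?J = "Tile j 1 0 :: 'i tile" and ?w = "complex_of_real l ^ k * z"
    have J: "?J \<in> tiles" by (simp add: tiles_def)
    have int_eq: "interior (inflated k ?J) = (\<lambda>z. l ^ k * z) ` interior (P j)"
      using interior_inflated[OF J, of k] by simp
    have "z \<in> P j" using d interior_subset by (metis centre_in_ball subsetD)
    then have "?w \<in> inflated k ?J" by (auto simp: inflated_similarity)
    then obtain T0 where T0: "T0 \<in> super k j" "?w \<in> support P T0"
      using support_super[of k j] by blast
    have T0t: "T0 \<in> tiles" using T0(1) super_tiles by blast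
    have T0_int: "support P T0 \<subseteq> interior (inflated k ?J)"
    proof
      fix y assume "y \<in> support P T0"
      then have "dist ?w y \<le> diam"
        using dist_inflated[OF T0t, of ?w 0 y] T0(2) by (simp add: inflated_0)
      also have "\<dots> < l ^ k * d" using k d by (simp add: field_simps)
      finally have "dist ?w y < l ^ k * d" .
      moreover have "?w - y = complex_of_real l ^ k * (z - y / l ^ k)"
        using l_gt_1 by (simp add: right_diff_distrib)
      ultimately have "cmod (complex_of_real l ^ k * (z - y / l ^ k)) < l ^ k * d"
        by (simp only: dist_norm)
      then have "y / l ^ k \<in> ball z d"
        using l_gt_1 by (simp add: dist_norm norm_mult norm_power)
      then show "y \<in> interior (inflated k ?J)"
        unfolding int_eq using d l_gt_1 by (intro image_eqI[of _ _ "y / l ^ k"]) auto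
    qed
    let ?S = "super k j - {T0}"
    have "inflated k ?J - interior (inflated k ?J) \<subseteq> (\<Union>T\<in>?S. inflated 0 T - interior (inflated 0 T))"
    proof
      fix y assume y: "y \<in> inflated k ?J - interior (inflated k ?J)"
      then obtain T where T: "T \<in> super k j" "y \<in> support P T" using support_super[of k j] by blast
      have "T \<noteq> T0" using y T T0_int by blast
      moreover have "interior (support P T) \<subseteq> interior (inflated k ?J)"
        using T(1) support_super[of k j] by (intro interior_mono) blast
      ultimately show "y \<in> (\<Union>T\<in>?S. inflated 0 T - interior (inflated 0 T))"
        using y T by (auto simp: inflated_0)
    qed
    moreover have fm: "inflated n T - interior (inflated n T) \<in> fmeasurable lborel" for n T
    proof -
      have "bounded (inflated n T - interior (inflated n T))"
        using compact_inflated by (meson Diff_subset bounded_subset compact_imp_bounded)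
      then show ?thesis
        using emeasure_bounded_finite borel_compact[OF compact_inflated] by (auto simp: fmeasurable_def)
    qed
    ultimately have "l ^ (2 * k) * e j \<le> measure lborel (\<Union>T\<in>?S. inflated 0 T - interior (inflated 0 T))"
      using bd[OF J, of k] finite_super[of k j]
      by (metis (no_types, lifting) finite_Diff fmeasurable.finite_UN fmeasurableD measure_mono_fmeasurable tile.sel(1))
    also have "\<dots> \<le> (\<Sum>T\<in>?S. measure lborel (inflated 0 T - interior (inflated 0 T)))"
      using finite_super by (intro measure_UNION_le finite_Diff fmeasurableD[OF fm])
    also have "\<dots> = (\<Sum>T\<in>?S. e (proto T))"
      using super_tiles by (intro sum.cong refl) (use bd[of _ 0] in auto)
    also have "\<dots> \<le> (\<Sum>T\<in>?S. c * area (proto T))" by (intro sum_mono c_ge)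
    also have "\<dots> = c * ((\<Sum>T\<in>super k j. area (proto T)) - area (proto T0))"
      using T0(1) finite_super by (simp add: sum_distrib_left[symmetric] sum_diff1)
    \<comment> \<open>Strictness is the share of the interior tile \<open>T0\<close>, and it
      contradicts the maximality expressed by \<open>j\<close>.\<close>
    also have "\<dots> < c * (\<Sum>T\<in>super k j. area (proto T))"
      using c area_pos by simp
    also have "\<dots> \<le> c * (l ^ (2 * k) * area j)"
      using c sum_area_super[of k j] by simp
    finally show False using j by simp
  qed
  then have "e i \<le> 0" using c_ge[of i] area_pos[of i] by (meson mult_nonpos_nonneg less_imp_le order_trans)
  then show ?thesis using e0[of i] unfolding e_def by linarith
qed

text \<open>A layer of fixed width \<open>R\<close> in a k-th order supertile has width R / l^k when
  scaled back to the prototile, so its share of the area tends to the share of the boundary, which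
  is null.\<close>

lemma measure_layer_P_tendsto:
  assumes "R > 0"
  shows "(\<lambda>k. measure lborel (layer (R / l ^ k) (P i))) \<longlonglongrightarrow> 0"
proof -
  have "(\<lambda>k. R / l ^ k) \<longlonglongrightarrow> 0"
    using LIMSEQ_divide_realpow_zero[OF l_gt_1] .
  moreover have "decseq (\<lambda>k. R / l ^ k)"
    using assms l_gt_1 by (auto simp: decseq_def intro!: divide_left_mono power_increasing)
  ultimately show ?thesis
    using measure_layer_tendsto[OF compact_P, of "\<lambda>k. R / l ^ k" i] assms l_gt_1 boundary_null[of i] by simp
qed

lemma card_points_near:
  assumes "G \<subseteq> tiles" "non_overlapping P G"
  shows "finite {S \<in> G. point S \<in> cball z r}"
    and "card {S \<in> G. point S \<in> cball z r} * min_area \<le> measure lborel (cball z (r + diam))"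
proof -
  let ?G = "{S \<in> G. point S \<in> cball z r}"
  have G: "?G \<subseteq> tiles" "non_overlapping P ?G"
    using assms by (auto intro: non_overlapping_subset)
  have sub: "support P S \<subseteq> cball z (r + diam)" if "S \<in> ?G" for S
  proof
    fix y assume "y \<in> support P S"
    then have "dist (point S) y \<le> diam"
      using dist_inflated[of S "point S" 0 y] that G(1) point_in_support[of S] by (auto simp: inflated_0)
    then show "y \<in> cball z (r + diam)" using that dist_triangle[of z y "point S"] by auto
  qed
  have Z: "cball z (r + diam) \<in> fmeasurable lborel"
    using emeasure_bounded_finite[OF bounded_cball] by (simp add: fmeasurable_def)
  show "finite ?G" "card ?G * min_area \<le> measure lborel (cball z (r + diam))"
    by (rule card_le[OF G sub Z], assumption)+
qed

end

section \<open>Angular modes of a substitution\<close>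

text \<open>By induction on n, eventually t k \<le> q^n * C + \<epsilon>. The uniform bound
  \<open>C\<close> starts the induction.\<close>

lemma contraction_tendsto_0:
  fixes t e :: "nat \<Rightarrow> real"
  assumes t: "\<And>k. 0 \<le> t k" "\<And>k. t k \<le> C" and q: "0 \<le> q" "q < 1"
    and step: "\<And>k. t (k + N) \<le> q * t k + e k" and e: "e \<longlonglongrightarrow> 0"
  shows "t \<longlonglongrightarrow> 0"
proof -
  have C: "0 \<le> C" using t[of 0] by linarith
  have ev: "eventually (\<lambda>k. t k \<le> q ^ n * C + \<epsilon>) sequentially" if \<epsilon>: "\<epsilon> > 0" for n \<epsilon>
  proof (induction n)
    case 0
    show ?case using t(2) \<epsilon> by (intro always_eventually allI) (simp add: add_increasing2)
  next
    case (Suc n)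
    \<comment> \<open>The threshold makes \<epsilon> a fixed point of the step: q * \<epsilon> +
      \<epsilon> * (1 - q) = \<epsilon>.\<close>
    have "eventually (\<lambda>k. e k < \<epsilon> * (1 - q)) sequentially"
      using order_tendstoD(2)[OF e, of "\<epsilon> * (1 - q)"] \<epsilon> q by simp
    with Suc have "eventually (\<lambda>k. t (k + N) \<le> q ^ Suc n * C + \<epsilon>) sequentially"
    proof eventually_elim
      case (elim k)
      have "t (k + N) \<le> q * t k + e k" by (rule step)
      also have "\<dots> \<le> q * (q ^ n * C + \<epsilon>) + \<epsilon> * (1 - q)"
        using elim q by (intro add_mono mult_left_mono) auto
      finally show ?case by (simp add: algebra_simps)
    qed
    then show ?case by (subst (asm) eventually_sequentially_seg)
  qed
  show ?thesis
  proof (rule tendstoI)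
    fix \<epsilon> :: real assume \<epsilon>: "\<epsilon> > 0"
    have "(\<lambda>n. q ^ n * C) \<longlonglongrightarrow> 0 * C"
      using q by (intro tendsto_mult_right LIMSEQ_realpow_zero)
    then have "eventually (\<lambda>n. q ^ n * C < \<epsilon> / 2) sequentially"
      using \<epsilon> by (intro order_tendstoD(2)) auto
    then obtain n where n: "q ^ n * C < \<epsilon> / 2" by (auto simp: eventually_sequentially)
    show "eventually (\<lambda>k. dist (t k) 0 < \<epsilon>) sequentially"
      using ev[OF half_gt_zero[OF \<epsilon>], of n]
    proof eventually_elim
      case (elim k)
      then show ?case using n t(1)[of k] by simp
    qed
  qed
qed

text \<open>Strict triangle inequality on the unit circle, from the parallelogram law. It is the
  source of all cancellation.\<close>

lemma norm_add_less_2: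
  fixes a b :: complex
  assumes "cmod a = 1" "cmod b = 1" "a \<noteq> b"
  shows "cmod (a + b) < 2"
proof -
  have "(cmod (a + b))\<^sup>2 + (cmod (a - b))\<^sup>2 = 2 * (cmod a)\<^sup>2 + 2 * (cmod b)\<^sup>2"
    unfolding cmod_power2 by (simp add: power2_eq_square algebra_simps)
  moreover have "(cmod (a - b))\<^sup>2 > 0" using assms(3) by simp
  ultimately have "(cmod (a + b))\<^sup>2 < 4" unfolding assms(1,2) power_one by linarith
  then have "(cmod (a + b))\<^sup>2 < 2\<^sup>2" by simp
  then show ?thesis by (rule power2_less_imp_less) simp
qed

locale angular_mode = self_similar_substitution P l \<sigma> x + pair_kernel F \<rho> B
  for P :: "'i::finite \<Rightarrow> complex set" and l \<sigma> x F \<rho> B +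
  fixes m :: nat
  assumes mode: "\<And>u z. cmod u = 1 \<Longrightarrow> F (u * z) = u ^ m * F z" and \<rho>_pos: "\<rho> > 0"
begin

definition points :: "'i tile set \<Rightarrow> complex set" where
  "points G = point ` G"

text \<open>A bound for the number of control points in a ball of radius \<rho>: their tiles lie in
  the ball enlarged by \<open>diam\<close>, and each uses up \<open>min_area\<close>.\<close>

definition density :: nat where
  "density = nat \<lfloor>measure lborel (cball 0 (\<rho> + diam) :: complex set) / min_area\<rfloor>"

definition mode_sum :: "nat \<Rightarrow> 'i \<Rightarrow> complex" where
  "mode_sum k i = pair_sum F (points (super k i))"

text \<open>The factor 2 * (B * density) comes from \<open>pair_sum_decomposition\<close>. One
  division by \<open>min_area\<close> turns the area of a layer into a number of tiles, the other
  turns a bound per supertile into a multiple of the area of its type.\<close>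

definition boundary_error :: "nat \<Rightarrow> real" where
  "boundary_error k = 2 * (B * density) * ((\<Sum>i\<in>UNIV. measure lborel (layer ((\<rho> + diam) / l ^ k) (P i))) / min_area / min_area)"

text \<open>The norm in which the recursion contracts: a maximum norm on the types, weighted by the
  areas of the supertiles.\<close>

definition mode_ratio :: "nat \<Rightarrow> real" where
  "mode_ratio k = Max (range (\<lambda>i. cmod (mode_sum k i) / (l ^ (2 * k) * area i)))"

lemma boundary_error_tendsto: "boundary_error \<longlonglongrightarrow> 0"
proof -
  have "(\<lambda>k. 2 * (B * density) * ((\<Sum>i\<in>UNIV. measure lborel (layer ((\<rho> + diam) / l ^ k) (P i))) / min_area / min_area))
      \<longlonglongrightarrow> 2 * (B * density) * ((\<Sum>i\<in>(UNIV :: 'i set). 0) / min_area / min_area)"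
    using \<rho>_pos diam_nonneg min_area_pos
    by (intro tendsto_intros measure_layer_P_tendsto) auto
  then show ?thesis by (simp add: boundary_error_def[abs_def])
qed

lemma boundary_error_nonneg: "0 \<le> boundary_error k"
  unfolding boundary_error_def using B_nonneg min_area_pos by (simp add: sum_nonneg)

lemma card_points_cball:
  assumes "G \<subseteq> tiles" "non_overlapping P G"
  shows "card (points G \<inter> cball z \<rho>) \<le> density"
proof -
  let ?G = "{S \<in> G. point S \<in> cball z \<rho>}"
  have "points G \<inter> cball z \<rho> = point ` ?G" by (auto simp: points_def)
  then have "card (points G \<inter> cball z \<rho>) \<le> card ?G"
    using card_image_le[OF card_points_near(1)[OF assms], of point z \<rho>] by simp
  also have "card ?G \<le> density"
  proof -
    have "measure lborel (cball z (\<rho> + diam)) = measure lborel (cball 0 (\<rho> + diam) :: complex set)"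
      using \<rho>_pos diam_nonneg by (simp add: content_cball)
    then have "real (card ?G) \<le> measure lborel (cball 0 (\<rho> + diam) :: complex set) / min_area"
      using card_points_near(2)[OF assms, of z \<rho>] min_area_pos by (simp add: pos_le_divide_eq)
    then show ?thesis unfolding density_def by linarith
  qed
  finally show ?thesis .
qed

lemma finite_points_iter: "finite A \<Longrightarrow> finite (points (iter k A))"
  by (simp add: points_def finite_iter)

lemma points_iter_subset: "points (iter k {T}) \<subseteq> inflated k T"
proof
  fix p assume "p \<in> points (iter k {T})"
  then obtain S where "S \<in> iter k {T}" "p = point S" by (auto simp: points_def)
  then show "p \<in> inflated k T" using support_iter[of k "{T}"] point_in_support[of S] by auto
qed

lemma points_iter_UN: "points (iter k A) = (\<Union>T\<in>A. points (iter k {T}))"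
  by (subst subst_iterate_UN) (auto simp: points_def)

lemma pair_sum_iter_tile:
  assumes "T \<in> tiles"
  shows "pair_sum F (points (iter k {T})) = rot T ^ m * mode_sum k (proto T)"
proof -
  have "points (iter k {T}) = (\<lambda>z. rot T * z + l ^ k *\<^sub>R shift T) ` points (super k (proto T))"
    unfolding subst_iterate_tile by (auto simp: points_def point_move image_image)
  then show ?thesis
    using assms mode by (simp add: pair_sum_similarity mode_sum_def tiles_def)
qed

text \<open>A tile whose control point is within \<rho> of the outside lies wholly in the layer of
  width \<rho> + diam, so the area of that layer counts such tiles. Summing over all types makes the
  bound independent of the type of \<open>T\<close>.\<close>

lemma card_boundary_points:
  assumes T: "T \<in> tiles"
  shows "card {p \<in> points (iter k {T}). \<not> cball p \<rho> \<subseteq> interior (inflated k T)} \<le>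
    l ^ (2 * k) * (\<Sum>i\<in>UNIV. measure lborel (layer ((\<rho> + diam) / l ^ k) (P i))) / min_area"
proof -
  let ?J = "inflated k T" and ?L = "layer (\<rho> + diam) (inflated k T)"
  let ?G = "{S \<in> iter k {T}. \<not> cball (point S) \<rho> \<subseteq> interior ?J}"
  have it: "iter k {T} \<subseteq> tiles" "non_overlapping P (iter k {T})"
    using T iter_tiles[of "{T}" k] non_overlapping_iter[of "{T}" k] by (simp_all add: non_overlapping_def)
  have sub: "support P S \<subseteq> ?L" if "S \<in> ?G" for S
  proof
    fix y assume y: "y \<in> support P S"
    then have "y \<in> ?J" using support_iter[of k "{T}"] that by auto
    moreover have "\<not> cball y (\<rho> + diam) \<subseteq> interior ?J"
    proof
      assume *: "cball y (\<rho> + diam) \<subseteq> interior ?J"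
      have d: "dist y (point S) \<le> diam"
        using dist_inflated[of S y 0 "point S"] that it(1) y point_in_support[of S] by (auto simp: inflated_0)
      have "cball (point S) \<rho> \<subseteq> cball y (\<rho> + diam)"
      proof
        fix w assume "w \<in> cball (point S) \<rho>"
        then show "w \<in> cball y (\<rho> + diam)"
          using d dist_triangle[of y w "point S"] unfolding mem_cball by linarith
      qed
      then show False using * that by blast
    qed
    ultimately show "y \<in> ?L" by (simp add: layer_def)
  qed
  have "bounded ?L"
    by (rule bounded_subset[OF compact_imp_bounded[OF compact_inflated[of k T]]]) (auto simp: layer_def)
  moreover have "closed ?L" by (intro closed_layer compact_imp_closed compact_inflated)
  ultimately have L: "?L \<in> fmeasurable lborel"
    using emeasure_bounded_finite[of ?L] by (simp add: fmeasurable_def)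
  have G: "?G \<subseteq> tiles" "non_overlapping P ?G"
    using it non_overlapping_subset[of P "iter k {T}" ?G] by auto
  have "{p \<in> points (iter k {T}). \<not> cball p \<rho> \<subseteq> interior ?J} = point ` ?G"
    by (auto simp: points_def)
  then have "card {p \<in> points (iter k {T}). \<not> cball p \<rho> \<subseteq> interior ?J} \<le> card ?G"
    using card_image_le[of ?G point] finite_iter[of "{T}" k] by simp
  also have "card ?G \<le> measure lborel ?L / min_area"
    using card_le(2)[OF G sub L] min_area_pos by (simp add: pos_le_divide_eq)
  also have "\<dots> \<le> l ^ (2 * k) * (\<Sum>i\<in>UNIV. measure lborel (layer ((\<rho> + diam) / l ^ k) (P i))) / min_area"
    unfolding layer_inflated[OF T] using l_gt_1 min_area_pos
    by (intro divide_right_mono mult_left_mono member_le_sum) auto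
  finally show ?thesis by simp
qed

text \<open>The approximate recursion, for an arbitrary patch \<open>A\<close> because it is applied
  twice: to a supertile, which relates orders k and k + N, and to the tiles whose supertiles fill a
  ball.\<close>

lemma pair_sum_iter:
  assumes A: "finite A" "A \<subseteq> tiles" "non_overlapping P A"
  shows "cmod (pair_sum F (points (iter k A)) - (\<Sum>T\<in>A. rot T ^ m * mode_sum k (proto T))) \<le>
    boundary_error k * (l ^ (2 * k) * (\<Sum>T\<in>A. area (proto T)))"
proof -
  let ?Y = "\<lambda>T. {p \<in> points (iter k {T}). \<not> cball p \<rho> \<subseteq> interior (inflated k T)}"
  let ?M = "\<Sum>i\<in>UNIV. measure lborel (layer ((\<rho> + diam) / l ^ k) (P i))"
  have "cmod (pair_sum F (\<Union>T\<in>A. points (iter k {T})) - (\<Sum>T\<in>A. pair_sum F (points (iter k {T})))) \<le>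
      2 * (B * density) * (\<Sum>T\<in>A. card (?Y T))"
  proof (rule pair_sum_decomposition[OF less_imp_le[OF \<rho>_pos] A(1)])
    show "card ((\<Union>T\<in>A. points (iter k {T})) \<inter> cball z \<rho>) \<le> density" for z
      unfolding points_iter_UN[symmetric]
      using A by (intro card_points_cball iter_tiles non_overlapping_iter)
    show "interior (inflated k S) \<inter> inflated k T = {}" if "S \<in> A" "T \<in> A" "S \<noteq> T" for S T
      using that by (intro interior_inflated_disjoint[OF A(2,3)])
  qed (auto simp: finite_points_iter points_iter_subset)
  also have "(\<Sum>T\<in>A. pair_sum F (points (iter k {T}))) = (\<Sum>T\<in>A. rot T ^ m * mode_sum k (proto T))"
    using A(2) by (intro sum.cong refl pair_sum_iter_tile) auto
  also have "real (\<Sum>T\<in>A. card (?Y T)) \<le> (\<Sum>T\<in>A. (l ^ (2 * k) * ?M / min_area / min_area) * area (proto T))"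
    unfolding of_nat_sum
  proof (rule sum_mono)
    fix T assume "T \<in> A"
    then have "real (card (?Y T)) \<le> l ^ (2 * k) * ?M / min_area"
      using card_boundary_points A(2) by blast
    also have "\<dots> = (l ^ (2 * k) * ?M / min_area / min_area) * min_area" using min_area_pos by simp
    also have "\<dots> \<le> (l ^ (2 * k) * ?M / min_area / min_area) * area (proto T)"
      using min_area_pos min_area_le l_gt_1
      by (intro mult_left_mono divide_nonneg_nonneg mult_nonneg_nonneg sum_nonneg) auto
    finally show "real (card (?Y T)) \<le> (l ^ (2 * k) * ?M / min_area / min_area) * area (proto T)" .
  qed
  then have "2 * (B * density) * real (\<Sum>T\<in>A. card (?Y T)) \<le>
      2 * (B * density) * (\<Sum>T\<in>A. (l ^ (2 * k) * ?M / min_area / min_area) * area (proto T))"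
    using B_nonneg by (intro mult_left_mono) auto
  also have "\<dots> = boundary_error k * (l ^ (2 * k) * (\<Sum>T\<in>A. area (proto T)))"
    unfolding sum_distrib_left[symmetric] boundary_error_def by (simp add: field_simps)
  finally show ?thesis by (simp add: points_iter_UN[of k A])
qed

lemma mode_sum_le: "cmod (mode_sum k i) \<le> mode_ratio k * l ^ (2 * k) * area i"
proof -
  have "cmod (mode_sum k i) / (l ^ (2 * k) * area i) \<le> mode_ratio k" unfolding mode_ratio_def by (intro Max_ge) auto
  then show ?thesis using area_pos[of i] l_power_pos[of "2 * k"]
    by (simp add: pos_divide_le_eq mult.assoc)
qed

lemma mode_ratio_attained: obtains i where "mode_ratio k * (l ^ (2 * k) * area i) = cmod (mode_sum k i)"
proof -
  have "mode_ratio k \<in> range (\<lambda>i. cmod (mode_sum k i) / (l ^ (2 * k) * area i))" unfolding mode_ratio_def by (intro Max_in) auto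
  then obtain i where i: "mode_ratio k = cmod (mode_sum k i) / (l ^ (2 * k) * area i)" by blast
  have "l ^ (2 * k) * area i \<noteq> 0" using area_pos[of i] l_gt_1 by simp
  then have "mode_ratio k * (l ^ (2 * k) * area i) = cmod (mode_sum k i)"
    unfolding i by (rule nonzero_eq_divide_eq[THEN iffD1]) (rule refl)
  then show thesis using that by blast
qed

lemma scaled_area_pos: "0 < l ^ k * area i"
  by (intro mult_pos_pos l_power_pos area_pos)

lemma mode_ratio_nonneg: "0 \<le> mode_ratio k"
proof -
  obtain i where i: "mode_ratio k * (l ^ (2 * k) * area i) = cmod (mode_sum k i)" by (rule mode_ratio_attained)
  have "0 * (l ^ (2 * k) * area i) \<le> mode_ratio k * (l ^ (2 * k) * area i)" unfolding i by simp
  then show ?thesis by (rule mult_right_le_imp_le) (rule scaled_area_pos)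
qed

lemma mode_ratio_bounded: "mode_ratio k \<le> B * density / min_area"
proof -
  obtain i where i: "mode_ratio k * (l ^ (2 * k) * area i) = cmod (mode_sum k i)" by (rule mode_ratio_attained)
  have fin: "finite (points (super k i))" by (simp add: points_def finite_super)
  have "cmod (mode_sum k i) \<le> card (points (super k i)) * (B * density)"
    unfolding mode_sum_def pair_sum_def
    using card_points_cball[OF super_tiles non_overlapping_super] fin by (intro partial_pair_sum_bound) auto
  also have "\<dots> \<le> (l ^ (2 * k) * area i / min_area) * (B * density)"
  proof (rule mult_right_mono)
    have "card (points (super k i)) * min_area \<le> card (super k i) * min_area"
      using card_image_le[OF finite_super, of point k i] min_area_pos by (simp add: points_def)
    also have "\<dots> \<le> (\<Sum>T\<in>super k i. area (proto T))"
      using sum_bounded_below[of "super k i" min_area "\<lambda>T. area (proto T)"] min_area_le by simp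
    also have "\<dots> \<le> l ^ (2 * k) * area i" by (rule sum_area_super)
    finally show "real (card (points (super k i))) \<le> l ^ (2 * k) * area i / min_area"
      using min_area_pos by (simp add: pos_le_divide_eq)
  qed (use B_nonneg in simp)
  finally have "mode_ratio k * (l ^ (2 * k) * area i) \<le> (B * density / min_area) * (l ^ (2 * k) * area i)"
    unfolding i by (simp add: field_simps)
  then show ?thesis by (rule mult_right_le_imp_le) (rule scaled_area_pos)
qed

lemma nonneg_of_area_bound: "cmod z \<le> c * area i \<Longrightarrow> 0 \<le> c"
proof -
  assume "cmod z \<le> c * area i"
  then have "0 * area i \<le> c * area i" using norm_ge_zero[of z] by linarith
  then show ?thesis by (rule mult_right_le_imp_le) (rule area_pos)
qed

section \<open>Cancellation and decay of the mode sums\<close>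

lemma contraction:
  assumes sep: "\<And>j. \<exists>S\<in>super N j. \<exists>T\<in>super N j. proto S = proto T \<and> rot S ^ m \<noteq> rot T ^ m"
  shows "\<exists>q\<ge>0. q < 1 \<and> (\<forall>v c j. (\<forall>i. cmod (v i) \<le> c * area i) \<longrightarrow>
      cmod (\<Sum>T\<in>super N j. rot T ^ m * v (proto T)) \<le> q * (c * (l ^ (2 * N) * area j)))"
proof -
  define Q where "Q j \<epsilon> \<longleftrightarrow> \<epsilon> > 0 \<and> (\<forall>v c. (\<forall>i. cmod (v i) \<le> c * area i) \<longrightarrow>
      cmod (\<Sum>T\<in>super N j. rot T ^ m * v (proto T)) \<le> (1 - \<epsilon>) * (c * (l ^ (2 * N) * area j)))" for j \<epsilon>
  have "\<exists>\<epsilon>. Q j \<epsilon>" for j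
  proof -
    obtain S T where ST: "S \<in> super N j" "T \<in> super N j" "proto S = proto T" "rot S ^ m \<noteq> rot T ^ m"
      using sep by blast
    define i0 where "i0 = proto T"
    \<comment> \<open>What the pair \<open>S\<close>, \<open>T\<close> saves against the trivial
      bound 2 for the sum of its two phases. Having the same type, both tiles multiply the same
      value \<open>v i0\<close>, so the saving holds for every \<open>v\<close>.\<close>
    define \<eta> where "\<eta> = 2 - cmod (rot S ^ m + rot T ^ m)"
    have unit: "cmod (rot W ^ m) = 1" if "W \<in> super N j" for W
      using subsetD[OF super_tiles that] by (simp add: tiles_def norm_power)
    have \<eta>: "\<eta> > 0" unfolding \<eta>_def using norm_add_less_2[OF unit unit ST(4)] ST by simp
    define a where "a = l ^ (2 * N) * area j"
    have a: "a > 0" unfolding a_def using l_power_pos area_pos by simp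
    have "cmod (\<Sum>W\<in>super N j. rot W ^ m * v (proto W)) \<le> (1 - \<eta> * area i0 / a) * (c * a)"
      if v: "\<forall>i. cmod (v i) \<le> c * area i" for v c
    proof -
      have c: "c \<ge> 0" using v nonneg_of_area_bound by blast
      have ne: "S \<noteq> T" using ST(4) by auto
      let ?R = "super N j - {S, T}"
      have split: "(\<Sum>W\<in>super N j. f W) = (f S + f T) + (\<Sum>W\<in>?R. f W)" for f :: "'i tile \<Rightarrow> complex"
        using sum.subset_diff[of "{S, T}" "super N j" f] ST finite_super ne by (simp add: add.commute)
      have split_area: "(\<Sum>W\<in>super N j. area (proto W)) = area i0 + area i0 + (\<Sum>W\<in>?R. area (proto W))"
        using sum.subset_diff[of "{S, T}" "super N j" "\<lambda>W. area (proto W)"] ST finite_super ne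
        by (simp add: add.commute i0_def)
      have "cmod (\<Sum>W\<in>super N j. rot W ^ m * v (proto W)) \<le>
          cmod ((rot S ^ m + rot T ^ m) * v i0) + cmod (\<Sum>W\<in>?R. rot W ^ m * v (proto W))"
        unfolding split ST(3) i0_def distrib_right by (rule norm_triangle_ineq)
      also have "cmod ((rot S ^ m + rot T ^ m) * v i0) \<le> (2 - \<eta>) * (c * area i0)"
        unfolding norm_mult \<eta>_def using v by (simp add: mult_left_mono)
      also have "cmod (\<Sum>W\<in>?R. rot W ^ m * v (proto W)) \<le> (\<Sum>W\<in>?R. c * area (proto W))"
        using v unit by (intro sum_norm_le) (simp add: norm_mult)
      also have "(2 - \<eta>) * (c * area i0) + (\<Sum>W\<in>?R. c * area (proto W)) =
          c * (\<Sum>W\<in>super N j. area (proto W)) - \<eta> * (c * area i0)"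
        unfolding split_area by (simp add: sum_distrib_left algebra_simps)
      also have "\<dots> \<le> c * a - \<eta> * (c * area i0)"
        using mult_left_mono[OF sum_area_super[of N j] c] by (simp add: a_def)
      also have "\<dots> = (1 - \<eta> * area i0 / a) * (c * a)"
        using a by (simp add: field_simps)
      finally show ?thesis by simp
    qed
    moreover have "\<eta> * area i0 / a > 0" using \<eta> a area_pos by simp
    ultimately have "Q j (\<eta> * area i0 / a)" unfolding Q_def a_def by blast
    then show ?thesis ..
  qed
  then obtain f where Q: "Q j (f j)" for j by metis
  then have f: "f j > 0" for j by (simp add: Q_def)
  \<comment> \<open>One saving for all of the finitely many types; the cap at 1 keeps q = 1 -
    \<epsilon> nonnegative.\<close>
  define \<epsilon> where "\<epsilon> = min 1 (Min (range f))"
  have "Min (range f) \<in> range f" by (intro Min_in) auto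
  then have \<epsilon>: "\<epsilon> > 0" "\<epsilon> \<le> 1" using f by (auto simp: \<epsilon>_def)
  have \<epsilon>f: "\<epsilon> \<le> f j" for j unfolding \<epsilon>_def by (intro min.coboundedI2 Min_le) auto
  show ?thesis
  proof (intro exI[of _ "1 - \<epsilon>"] conjI allI impI)
    fix v c j assume v: "\<forall>i. cmod (v i) \<le> c * area i"
    then have c: "0 \<le> c" using nonneg_of_area_bound by blast
    have "cmod (\<Sum>T\<in>super N j. rot T ^ m * v (proto T)) \<le> (1 - f j) * (c * (l ^ (2 * N) * area j))"
      using Q[of j] v unfolding Q_def by blast
    also have "\<dots> \<le> (1 - \<epsilon>) * (c * (l ^ (2 * N) * area j))"
      using \<epsilon>f[of j] by (intro mult_right_mono mult_nonneg_nonneg c less_imp_le[OF scaled_area_pos]) simp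
    finally show "cmod (\<Sum>T\<in>super N j. rot T ^ m * v (proto T)) \<le> (1 - \<epsilon>) * (c * (l ^ (2 * N) * area j))" .
  qed (use \<epsilon> in auto)
qed

lemma mode_ratio_tendsto:
  assumes sep: "\<And>j. \<exists>S\<in>super N j. \<exists>T\<in>super N j. proto S = proto T \<and> rot S ^ m \<noteq> rot T ^ m"
  shows "mode_ratio \<longlonglongrightarrow> 0"
proof -
  obtain q where q: "0 \<le> q" "q < 1" and
    contr: "\<forall>v c j. (\<forall>i. cmod (v i) \<le> c * area i) \<longrightarrow>
      cmod (\<Sum>T\<in>super N j. rot T ^ m * v (proto T)) \<le> q * (c * (l ^ (2 * N) * area j))"
    using contraction[OF sep] by blast
  have "mode_ratio (k + N) \<le> q * mode_ratio k + boundary_error k" for k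
  proof -
    \<comment> \<open>A type that attains the maximum at order k + N; a bound for its mode sum alone
      bounds the ratio.\<close>
    obtain j where j: "mode_ratio (k + N) * (l ^ (2 * (k + N)) * area j) = cmod (mode_sum (k + N) j)" by (rule mode_ratio_attained)
    let ?S = "\<Sum>T\<in>super N j. rot T ^ m * mode_sum k (proto T)"
    have "cmod (mode_sum (k + N) j - ?S) \<le> boundary_error k * (l ^ (2 * k) * (\<Sum>T\<in>super N j. area (proto T)))"
      using pair_sum_iter[OF finite_super super_tiles non_overlapping_super, of k N j]
      by (simp add: mode_sum_def subst_iterate_supertile)
    also have "\<dots> \<le> boundary_error k * (l ^ (2 * k) * (l ^ (2 * N) * area j))"
      using l_gt_1 by (intro mult_left_mono sum_area_super boundary_error_nonneg) auto
    finally have 1: "cmod (mode_sum (k + N) j - ?S) \<le> boundary_error k * (l ^ (2 * (k + N)) * area j)"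
      by (simp add: power_add mult_ac distrib_left)
    have "cmod ?S \<le> q * (mode_ratio k * l ^ (2 * k) * (l ^ (2 * N) * area j))"
      by (rule contr[rule_format]) (rule mode_sum_le)
    then have 2: "cmod ?S \<le> q * mode_ratio k * (l ^ (2 * (k + N)) * area j)"
      by (simp add: power_add mult_ac distrib_left)
    have "mode_ratio (k + N) * (l ^ (2 * (k + N)) * area j) \<le> (q * mode_ratio k + boundary_error k) * (l ^ (2 * (k + N)) * area j)"
      unfolding j distrib_right using 1 2 norm_triangle_sub[of "mode_sum (k + N) j" ?S] by linarith
    then show ?thesis by (rule mult_right_le_imp_le) (rule scaled_area_pos)
  qed
  from contraction_tendsto_0[OF mode_ratio_nonneg mode_ratio_bounded q this boundary_error_tendsto] show ?thesis .
qed

text \<open>Only k-th order supertiles lying inside the ball are kept. A discarded control point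
  belongs to a supertile that leaves the ball, so it is within l^k * diam of the bounding circle;
  area comparison in an annulus bounds the number of such points by a multiple of r. The lower bound
  on \<open>r\<close> keeps the inner radius of the annulus nonnegative.\<close>

lemma pair_sum_ball_bound:
  assumes G: "G \<subseteq> tiles" "non_overlapping P G"
    and cover: "\<And>H. finite H \<Longrightarrow> H \<subseteq> G \<Longrightarrow>
      \<exists>A. finite A \<and> A \<subseteq> tiles \<and> non_overlapping P A \<and> H \<subseteq> iter k A \<and> iter k A \<subseteq> G"
    and r: "r \<ge> l ^ k * diam + diam"
  shows "cmod (pair_sum F (points G \<inter> cball 0 r)) \<le>
    (mode_ratio k + boundary_error k) * (pi * r\<^sup>2) + 4 * (B * density) * (pi * (l ^ k * diam + 2 * diam) / min_area) * r"
proof -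
  define K where "K = l ^ k * diam"
  have K: "K \<ge> 0" unfolding K_def using l_gt_1 diam_nonneg by simp
  have r0: "r \<ge> 0" using r K diam_nonneg unfolding K_def by linarith
  have vol: "measure lborel (cball 0 a :: complex set) = pi * a\<^sup>2" if "a \<ge> 0" for a
    using that by (simp add: content_cball unit_ball_vol_2)
  have vol': "measure lborel (ball 0 a :: complex set) = pi * a\<^sup>2" if "a \<ge> 0" for a
    using that by (simp add: content_ball unit_ball_vol_2)
  let ?H = "{S \<in> G. point S \<in> cball 0 r}" and ?X = "points G \<inter> cball 0 r"
  have finH: "finite ?H" by (rule card_points_near(1)[OF G])
  have X_eq: "?X = points ?H" by (auto simp: points_def)
  then have finX: "finite ?X" using finH by (simp add: points_def)
  obtain A where A: "finite A" "A \<subseteq> tiles" "non_overlapping P A" "?H \<subseteq> iter k A" "iter k A \<subseteq> G"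
    using cover[OF finH] by auto
  define A1 where "A1 = {T \<in> A. inflated k T \<subseteq> cball 0 r}"
  have A1: "finite A1" "A1 \<subseteq> tiles" "non_overlapping P A1"
    using A non_overlapping_subset[of P A A1] by (auto simp: A1_def)
  let ?Y = "points (iter k A1)"
  have it: "iter k A1 \<subseteq> iter k A"
    by (rule subst_iterate_mono) (auto simp: A1_def)
  have YX: "?Y \<subseteq> ?X"
  proof
    fix p assume p: "p \<in> ?Y"
    then have "p \<in> (\<Union>T\<in>A1. points (iter k {T}))" using points_iter_UN by blast
    then obtain T where "T \<in> A1" "p \<in> inflated k T" using points_iter_subset by blast
    then have "p \<in> cball 0 r" unfolding A1_def by blast
    moreover have "p \<in> points G" using p it A(5) unfolding points_def by blast
    ultimately show "p \<in> ?X" by blast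
  qed
  let ?E = "{S \<in> G. r - K \<le> cmod (point S) \<and> cmod (point S) \<le> r}"
  \<comment> \<open>The collar of the discarded points, widened by \<open>diam\<close> on both sides
    so that it contains their whole tiles.\<close>
  let ?Z = "cball 0 (r + diam) - ball 0 (r - K - diam) :: complex set"
  have E: "?E \<subseteq> tiles" "non_overlapping P ?E"
    using G non_overlapping_subset[of P G ?E] by auto
  have E_sub: "support P S \<subseteq> ?Z" if S: "S \<in> ?E" for S
  proof
    fix y assume "y \<in> support P S"
    then have "dist y (point S) \<le> diam"
      using dist_inflated[of S y 0 "point S"] S E(1) point_in_support[of S] by (auto simp: inflated_0)
    then have "\<bar>cmod y - cmod (point S)\<bar> \<le> diam"
      using norm_triangle_ineq3[of y "point S"] unfolding dist_norm by linarith
    then show "y \<in> ?Z" using S by auto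
  qed
  have Z: "?Z \<in> fmeasurable lborel"
    using emeasure_bounded_finite[of ?Z] bounded_subset[OF bounded_cball, of ?Z 0 "r + diam"]
    by (auto simp: fmeasurable_def)
  have cE: "finite ?E" "card ?E * min_area \<le> measure lborel ?Z"
    by (rule card_le[OF E E_sub Z], assumption)+
  have "measure lborel ?Z = pi * (r + diam)\<^sup>2 - pi * (r - K - diam)\<^sup>2"
  proof -
    have "cball 0 (r + diam) \<in> fmeasurable (lborel :: complex measure)"
      using emeasure_bounded_finite[OF bounded_cball] by (simp add: fmeasurable_def)
    then have "measure lborel ?Z = measure lborel (cball 0 (r + diam) :: complex set) - measure lborel (ball 0 (r - K - diam) :: complex set)"
      using K diam_nonneg by (intro measurable_measure_Diff) auto
    then show ?thesis
      using r r0 diam_nonneg by (simp only: vol vol' K_def add_nonneg_nonneg diff_diff_eq diff_ge_0_iff_ge)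
  qed
  also have "\<dots> = pi * ((K + 2 * diam) * (2 * r - K))"
    by (simp add: power2_eq_square algebra_simps)
  also have "\<dots> \<le> pi * ((K + 2 * diam) * (2 * r))"
    using K diam_nonneg by (intro mult_left_mono) auto
  finally have Z_le: "measure lborel ?Z \<le> 2 * (pi * (K + 2 * diam)) * r" by (simp add: mult_ac)
  have "?X - ?Y \<subseteq> point ` ?E"
  proof
    fix p assume p: "p \<in> ?X - ?Y"
    then obtain S where S: "S \<in> ?H" "p = point S" unfolding X_eq points_def by blast
    then obtain T where T: "T \<in> A" "S \<in> iter k {T}" using A(4) subst_iterate_UN[of k l \<sigma> A] by blast
    have "T \<notin> A1"
    proof
      assume "T \<in> A1"
      then have "S \<in> iter k A1" using T(2) subst_iterate_UN[of k l \<sigma> A1] by blast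
      then show False using p S(2) by (auto simp: points_def)
    qed
    then have "\<not> inflated k T \<subseteq> cball 0 r" using T(1) by (simp add: A1_def)
    then obtain w where "w \<in> inflated k T" "w \<notin> cball 0 r" by blast
    then have w: "w \<in> inflated k T" "cmod w > r" by simp_all
    have "point S \<in> inflated k T" using T(2) points_iter_subset[of k T] by (auto simp: points_def)
    then have "dist w (point S) \<le> K"
      using dist_inflated[of T w k "point S"] T(1) A(2) w(1) by (auto simp: K_def)
    then have "cmod (point S) \<ge> r - K"
      using norm_triangle_ineq2[of w "point S"] w(2) unfolding dist_norm by linarith
    then show "p \<in> point ` ?E" using S by auto
  qed
  then have "card (?X - ?Y) \<le> card ?E"
    by (rule order_trans[OF card_mono[OF finite_imageI[OF cE(1)]] card_image_le[OF cE(1)]])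
  then have "card (?X - ?Y) * min_area \<le> card ?E * min_area" using min_area_pos by simp
  also have "\<dots> \<le> 2 * (pi * (K + 2 * diam)) * r" using cE(2) Z_le by linarith
  finally have cXY: "real (card (?X - ?Y)) \<le> 2 * (pi * (K + 2 * diam) / min_area) * r"
    using min_area_pos by (simp add: pos_le_divide_eq)
  have DX: "card (?X \<inter> cball z \<rho>) \<le> density" for z
  proof -
    have "card (?X \<inter> cball z \<rho>) \<le> card (points ?H \<inter> cball z \<rho>)" unfolding X_eq ..
    also have "\<dots> \<le> density"
      using G non_overlapping_subset[of P G ?H] by (intro card_points_cball) auto
    finally show ?thesis .
  qed
  have "cmod (pair_sum F ?X - pair_sum F ?Y) \<le> 2 * card (?X - ?Y) * (B * density)"
    by (rule pair_sum_subset[OF finX DX YX])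
  also have "\<dots> \<le> 2 * (2 * (pi * (K + 2 * diam) / min_area) * r) * (B * density)"
    using cXY B_nonneg by (intro mult_right_mono mult_left_mono) auto
  finally have 1: "cmod (pair_sum F ?X - pair_sum F ?Y) \<le> 4 * (B * density) * (pi * (K + 2 * diam) / min_area) * r"
    by (simp add: mult_ac)
  let ?a = "l ^ (2 * k) * (\<Sum>T\<in>A1. area (proto T))" and ?s = "\<Sum>T\<in>A1. rot T ^ m * mode_sum k (proto T)"
  have "?a \<le> measure lborel (cball 0 r :: complex set)"
  proof (rule sum_area_le[OF A1])
    show "interior (inflated k T) \<subseteq> cball 0 r" if "T \<in> A1" for T
      using that interior_subset unfolding A1_def by blast
    show "cball 0 r \<in> fmeasurable (lborel :: complex measure)"
      using emeasure_bounded_finite[OF bounded_cball] by (simp add: fmeasurable_def)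
  qed
  then have a: "?a \<le> pi * r\<^sup>2" by (simp only: vol[OF r0])
  have "cmod ?s \<le> (\<Sum>T\<in>A1. mode_ratio k * l ^ (2 * k) * area (proto T))"
    using A1(2) mode_sum_le by (intro sum_norm_le) (auto simp: norm_mult norm_power tiles_def)
  also have "\<dots> = mode_ratio k * ?a" by (simp add: sum_distrib_left mult.assoc)
  finally have s: "cmod ?s \<le> mode_ratio k * ?a" .
  have "cmod (pair_sum F ?Y) \<le> (mode_ratio k + boundary_error k) * ?a"
    unfolding distrib_right
    using s pair_sum_iter[OF A1, of k] norm_triangle_sub[of "pair_sum F ?Y" ?s] by linarith
  also have "\<dots> \<le> (mode_ratio k + boundary_error k) * (pi * r\<^sup>2)"
    using a mode_ratio_nonneg boundary_error_nonneg by (intro mult_left_mono) auto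
  finally have 2: "cmod (pair_sum F ?Y) \<le> (mode_ratio k + boundary_error k) * (pi * r\<^sup>2)" .
  show ?thesis
    using 1 2 norm_triangle_sub[of "pair_sum F ?X" "pair_sum F ?Y"] unfolding K_def by linarith
qed

text \<open>The order of the limits matters: \<open>k\<close> is fixed first, which makes the area
  term small; the collar term, whose constant depends on \<open>k\<close>, then disappears as r
  grows.\<close>

lemma pair_sum_ball_tendsto:
  assumes G: "G \<subseteq> tiles" "non_overlapping P G"
    and cover: "\<And>k H. finite H \<Longrightarrow> H \<subseteq> G \<Longrightarrow>
      \<exists>A. finite A \<and> A \<subseteq> tiles \<and> non_overlapping P A \<and> H \<subseteq> iter k A \<and> iter k A \<subseteq> G"
    and t: "mode_ratio \<longlonglongrightarrow> 0"
  shows "((\<lambda>r. pair_sum F (points G \<inter> cball 0 r) / measure lborel (cball 0 r :: complex set)) \<longlongrightarrow> 0) at_top"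
proof (rule tendstoI)
  fix \<epsilon> :: real assume \<epsilon>: "\<epsilon> > 0"
  have "(\<lambda>k. mode_ratio k + boundary_error k) \<longlonglongrightarrow> 0 + 0" by (intro tendsto_add t boundary_error_tendsto)
  then have "eventually (\<lambda>k. mode_ratio k + boundary_error k < \<epsilon> / 2) sequentially"
    using \<epsilon> by (intro order_tendstoD(2)) auto
  then obtain k where k: "mode_ratio k + boundary_error k < \<epsilon> / 2" by (auto simp: eventually_sequentially)
  define C where "C = 4 * (B * density) * (pi * (l ^ k * diam + 2 * diam) / min_area)"
  have "((\<lambda>r. C / (pi * r)) \<longlongrightarrow> 0) at_top"
    by (intro tendsto_divide_0[OF tendsto_const] filterlim_at_top_imp_at_infinity
        filterlim_tendsto_pos_mult_at_top[OF tendsto_const pi_gt_zero filterlim_ident])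
  then have "eventually (\<lambda>r. C / (pi * r) < \<epsilon> / 2) at_top"
    using \<epsilon> by (intro order_tendstoD(2)) auto
  then show "eventually (\<lambda>r. dist (pair_sum F (points G \<inter> cball 0 r) / measure lborel (cball 0 r :: complex set)) 0 < \<epsilon>) at_top"
    using eventually_ge_at_top[of "l ^ k * diam + diam"] eventually_gt_at_top[of 0]
  proof eventually_elim
    case (elim r)
    have vol: "measure lborel (cball 0 r :: complex set) = pi * r\<^sup>2"
      using elim by (simp add: content_cball unit_ball_vol_2)
    have pos: "pi * r\<^sup>2 > 0" using elim by simp
    have "cmod (pair_sum F (points G \<inter> cball 0 r)) \<le> (mode_ratio k + boundary_error k) * (pi * r\<^sup>2) + C * r"
      unfolding C_def using pair_sum_ball_bound[OF G cover elim(2)] by blast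
    also have "C * r = (C / (pi * r)) * (pi * r\<^sup>2)" using elim by (simp add: power2_eq_square)
    also have "(mode_ratio k + boundary_error k) * (pi * r\<^sup>2) + \<dots> = (mode_ratio k + boundary_error k + C / (pi * r)) * (pi * r\<^sup>2)"
      by (simp add: distrib_right)
    also have "\<dots> < \<epsilon> * (pi * r\<^sup>2)"
    proof (rule mult_strict_right_mono[OF _ pos])
      show "mode_ratio k + boundary_error k + C / (pi * r) < \<epsilon>" using k elim(1) by linarith
    qed
    finally have "cmod (pair_sum F (points G \<inter> cball 0 r)) < \<epsilon> * (pi * r\<^sup>2)" .
    moreover have "cmod (complex_of_real (pi * r\<^sup>2)) = pi * r\<^sup>2"
      unfolding norm_of_real using pos by (rule abs_of_pos)
    ultimately show ?case
      unfolding vol dist_norm diff_0_right norm_divide using pos by (simp only: pos_divide_less_eq)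
  qed
qed

end

section \<open>Rotations within supertiles and covers by supertiles\<close>

context self_similar_substitution
begin

text \<open>A positive entry of a product of matrices of naturals has a positive term, and such a
  term gives a tile of type i inside the image of a tile of type h.\<close>

lemma primitive_super:
  assumes "primitive \<sigma>"
  obtains k where "\<And>i j. \<exists>T\<in>super k j. proto T = i"
proof -
  obtain k where k: "\<And>i j. (((**) (subst_matrix \<sigma>) ^^ k) (mat 1)) $ i $ j > 0"
    using assms unfolding primitive_def by blast
  have "\<exists>T\<in>super n j. proto T = i" if "(((**) (subst_matrix \<sigma>) ^^ n) (mat 1)) $ i $ j > 0" for n i j
    using that
  proof (induction n arbitrary: i)
    case 0
    then have "i = j" by (auto simp: mat_def split: if_splits)
    then show ?case by (simp add: supertile_def)
  next
    case (Suc n)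
    define X where "X = ((**) (subst_matrix \<sigma>) ^^ n) (mat 1)"
    have "(subst_matrix \<sigma> ** X) $ i $ j > 0" using Suc.prems by (simp add: X_def)
    then have "(\<Sum>h\<in>UNIV. subst_matrix \<sigma> $ i $ h * X $ h $ j) > 0"
      by (simp add: matrix_matrix_mult_def)
    then have "(\<Sum>h\<in>UNIV. subst_matrix \<sigma> $ i $ h * X $ h $ j) \<noteq> 0"
      by (rule gr_implies_not0)
    then obtain h where "subst_matrix \<sigma> $ i $ h * X $ h $ j \<noteq> 0"
      by (rule sum.not_neutral_contains_not_neutral)
    then have h: "subst_matrix \<sigma> $ i $ h > 0" "((**) (subst_matrix \<sigma>) ^^ n) (mat 1) $ h $ j > 0"
      unfolding X_def by auto
    then obtain T where T: "T \<in> super n j" "proto T = h" using Suc.IH by blast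
    have "card {S \<in> \<sigma> h. proto S = i} > 0" using h(1) by (simp add: subst_matrix_def)
    then have "{S \<in> \<sigma> h. proto S = i} \<noteq> {}" by (metis card.empty less_irrefl)
    then obtain S where S: "S \<in> \<sigma> h" "proto S = i" by blast
    have "move (rot T) (l *\<^sub>R shift T) S \<in> subst_tile l \<sigma> T" using S T by (simp add: subst_tile_def)
    then have "move (rot T) (l *\<^sub>R shift T) S \<in> super (Suc n) j"
      using T(1) by (auto simp: supertile_def subst_def)
    then show ?case using S(2) by (metis proto_move)
  qed
  then show thesis using that k by blast
qed

text \<open>A copy of the supertile with the separated pair occurs in every supertile of order n +
  k, for \<open>k\<close> from primitivity. The copy multiplies both phases by the same nonzero
  factor, so they remain different.\<close>

lemma separation:
  assumes prim: "primitive \<sigma>" and S: "S \<in> super n i" "T \<in> super n i" "proto S = proto T" "rot S ^ m \<noteq> rot T ^ m"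
  obtains N where "\<And>j. \<exists>S\<in>super N j. \<exists>T\<in>super N j. proto S = proto T \<and> rot S ^ m \<noteq> rot T ^ m"
proof -
  obtain k where k: "\<And>i j. \<exists>T\<in>super k j. proto T = i" using primitive_super[OF prim] by blast
  have "\<exists>S\<in>super (n + k) j. \<exists>T\<in>super (n + k) j. proto S = proto T \<and> rot S ^ m \<noteq> rot T ^ m" for j
  proof -
    obtain W where W: "W \<in> super k j" "proto W = i" using k by blast
    have "rot W \<noteq> 0" using W(1) super_tiles rot_nonzero by blast
    have in_super: "move (rot W) (l ^ n *\<^sub>R shift W) V \<in> super (n + k) j" if "V \<in> super n i" for V
    proof -
      have "move (rot W) (l ^ n *\<^sub>R shift W) V \<in> iter n {W}"
        using that W(2) by (simp add: subst_iterate_tile)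
      then show ?thesis
        unfolding subst_iterate_supertile[symmetric] subst_iterate_UN[of n l \<sigma> "super k j"] using W(1) by blast
    qed
    show ?thesis
      using in_super[OF S(1)] in_super[OF S(2)] S(3,4) \<open>rot W \<noteq> 0\<close>
      by (intro bexI[of _ "move (rot W) (l ^ n *\<^sub>R shift W) S"] bexI[of _ "move (rot W) (l ^ n *\<^sub>R shift W) T"])
         (auto simp: power_mult_distrib)
  qed
  then show thesis using that by blast
qed

lemma congruent_sym_super:
  assumes "congruent G (super k i)"
  obtains u v where "cmod u = 1" "G = move u v ` super k i"
proof -
  obtain u v where u: "cmod u = 1" and eq: "super k i = move u v ` G"
    using assms by (auto simp: congruent_def)
  have uu: "cnj u * u = 1" using u complex_norm_square[of u] by (simp add: mult.commute)
  have "move (cnj u) (- cnj u * v) ` super k i = G"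
    unfolding eq image_image by (simp add: uu)
  then show thesis using that[of "cnj u" "- cnj u * v"] u by simp
qed

text \<open>
  Each initial patch of the numbering lies in a supertile up to congruence, so it has at most one
  value of \<open>u\<^sup>m\<close> for each type, and at most \<open>m\<close> rotations \<open>u\<close> for each value.
\<close>

lemma finite_rotations:
  fixes T :: "nat \<Rightarrow> 'i tile"
  assumes num: "supertile_numbering l \<sigma> T" and T: "range T \<subseteq> tiles" and m: "m > 0"
    and eq: "\<And>n j S S'. S \<in> super n j \<Longrightarrow> S' \<in> super n j \<Longrightarrow> proto S = proto S' \<Longrightarrow> rot S ^ m = rot S' ^ m"
  shows "finite (rot ` range T)"
proof (rule ccontr)
  let ?M = "CARD('i) * m"
  assume "infinite (rot ` range T)"
  then obtain R where R: "R \<subseteq> rot ` range T" "finite R" "card R = Suc ?M"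
    using infinite_arbitrarily_large by blast
  obtain J where J: "finite J" "R = (\<lambda>j. rot (T j)) ` J"
    using finite_subset_image[OF R(2), of "\<lambda>j. rot (T j)" UNIV] R(1) by (auto simp: image_image)
  obtain n where n: "J \<subseteq> {..<n}" using finite_nat_bounded[OF J(1)] by blast
  obtain L k i where L: "L \<ge> max n 1" and cong: "congruent (T ` {..<L}) (super k i)"
    using num unfolding supertile_numbering_def by (metis max.cobounded2)
  obtain u v where uv: "cmod u = 1" "T ` {..<L} = move u v ` super k i"
    using congruent_sym_super[OF cong] by blast
  have same: "rot S ^ m = rot S' ^ m"
    if S: "S \<in> T ` {..<L}" "S' \<in> T ` {..<L}" "proto S = proto S'" for S S'
  proof -
    obtain V V' where "V \<in> super k i" "V' \<in> super k i" "S = move u v V" "S' = move u v V'"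
      using S(1,2) unfolding uv(2) by blast
    then show ?thesis using eq[of V k i V'] S(3) by (simp add: power_mult_distrib)
  qed
  \<comment> \<open>Nonzero values are requested, also for types that do not occur, so that each
    type admits exactly \<open>m\<close> roots; together they allow no more than \<open>?M\<close>
    rotations.\<close>
  have "\<exists>c. c \<noteq> 0 \<and> (\<forall>S\<in>T ` {..<L}. proto S = h \<longrightarrow> rot S ^ m = c)" for h
  proof (cases "\<exists>S\<in>T ` {..<L}. proto S = h")
    case True
    then obtain S where S: "S \<in> T ` {..<L}" "proto S = h" by blast
    then have "rot S \<noteq> 0" using T rot_nonzero by blast
    then show ?thesis using same[OF _ S(1)] S(2) by (intro exI[of _ "rot S ^ m"]) auto
  next
    case False
    then show ?thesis by (intro exI[of _ 1]) auto
  qed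
  then obtain c where c: "\<And>h. c h \<noteq> 0" "\<And>S. S \<in> T ` {..<L} \<Longrightarrow> rot S ^ m = c (proto S)"
    by metis
  have "R \<subseteq> (\<Union>h. {z. z ^ m = c h})"
  proof
    fix z assume "z \<in> R"
    then obtain j where "j \<in> J" "z = rot (T j)" using J(2) by blast
    moreover from this have "T j \<in> T ` {..<L}" using n L by auto
    ultimately show "z \<in> (\<Union>h. {z. z ^ m = c h})" using c(2) by blast
  qed
  moreover have "finite (\<Union>h. {z. z ^ m = c h})" using m by (intro finite_UN_I) auto
  ultimately have "card R \<le> card (\<Union>h. {z. z ^ m = c h})" by (intro card_mono)
  also have "\<dots> \<le> (\<Sum>h\<in>UNIV. card {z. z ^ m = c h})" by (rule card_UN_le) simp
  also have "\<dots> = ?M" using card_nth_roots[OF c(1) m] by simp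
  finally show False using R(3) by simp
qed

text \<open>An initial patch that contains \<open>H\<close> is a moved supertile of some order K. If
  K \<ge> k, the same motion, with its translation scaled back, applied to the supertile of order K
  - k gives \<open>A\<close>.\<close>

lemma numbering_cover:
  fixes T :: "nat \<Rightarrow> 'i tile"
  assumes num: "supertile_numbering l \<sigma> T" and H: "finite H" "H \<subseteq> range T"
  shows "\<exists>A. finite A \<and> A \<subseteq> tiles \<and> non_overlapping P A \<and> H \<subseteq> iter k A \<and> iter k A \<subseteq> range T"
proof -
  obtain J where J: "finite J" "H = T ` J"
    using finite_subset_image[OF H(1), of T UNIV] H(2) by auto
  obtain n where n: "J \<subseteq> {..<n}" using finite_nat_bounded[OF J(1)] by blast
  \<comment> \<open>The total size of all supertiles of order below k: a patch with more tiles must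
    come from order at least k.\<close>
  define M where "M = (\<Sum>q<k. \<Sum>i\<in>UNIV. card (super q i))"
  obtain L K i where L: "L \<ge> max n (Suc M)" and cong: "congruent (T ` {..<L}) (super K i)"
    using num unfolding supertile_numbering_def by (metis Suc_le_eq le_add1 max.coboundedI2 plus_1_eq_Suc)
  obtain u v where uv: "cmod u = 1" "T ` {..<L} = move u v ` super K i"
    using congruent_sym_super[OF cong] by blast
  have "inj T" using num by (simp add: supertile_numbering_def)
  then have "L = card (T ` {..<L})" by (simp add: card_image inj_on_subset)
  also have "\<dots> \<le> card (super K i)" unfolding uv(2) by (rule card_image_le[OF finite_super])
  finally have LK: "L \<le> card (super K i)" .
  have "k \<le> K"
  proof (rule ccontr)
    assume "\<not> k \<le> K"
    then have "(\<Sum>i\<in>UNIV. card (super K i)) \<le> M" unfolding M_def by (intro member_le_sum) auto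
    moreover have "card (super K i) \<le> (\<Sum>i\<in>UNIV. card (super K i))" by (intro member_le_sum) auto
    ultimately show False using LK L by simp
  qed
  then have K: "super K i = iter k (super (K - k) i)" by (simp add: subst_iterate_supertile)
  \<comment> \<open>Each substitution multiplies translations by \<open>l\<close>, so k of them turn
    v / l^k back into \<open>v\<close>.\<close>
  define A where "A = move u (v / l ^ k) ` super (K - k) i"
  have "iter k A = T ` {..<L}"
    unfolding A_def subst_iterate_move uv(2) K using l_gt_1 by (simp add: scaleR_conv_of_real)
  moreover have "finite A" "A \<subseteq> tiles" "non_overlapping P A"
    unfolding A_def
    using finite_super super_tiles move_tiles[OF uv(1)] non_overlapping_move[OF uv(1) non_overlapping_super]
    by blast+
  moreover have "H \<subseteq> T ` {..<L}" using J(2) n L by auto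
  ultimately show ?thesis by (intro exI[of _ A]) (simp add: image_mono)
qed

end

text \<open>Finitely many orientations leave a gap. A closed interval inside the gap has frequency
  0, whereas statistical circular symmetry assigns it a positive limit.\<close>

lemma infinite_rotations:
  assumes "statistical_circular_symmetry P l \<sigma> T"
  shows "infinite (rot ` range T)"
proof
  assume "finite (rot ` range T)"
  then have fin: "finite (orientation ` range T)"
    unfolding orientation_def image_image[symmetric, of Arg2pi rot] by (rule finite_imageI)
  have "infinite ({0<..<1::real} - orientation ` range T)"
    using fin by (simp add: Diff_infinite_finite)
  then obtain p where p: "p \<in> {0<..<1} - orientation ` range T"
    using infinite_imp_nonempty by blast
  have "open ({0<..<1} - orientation ` range T)"
    using fin by (intro open_Diff finite_imp_closed) auto
  then obtain e where e: "e > 0" "cball p e \<subseteq> {0<..<1} - orientation ` range T"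
    using p open_contains_cball by blast
  have pe: "p + e \<in> cball p e" "p \<in> cball p e" using e(1) by (auto simp: dist_real_def)
  have sub: "{p..p + e} \<subseteq> cball p e" by (auto simp: dist_real_def)
  have range: "0 \<le> p" "p < p + e" "p + e < 2 * pi"
    using subsetD[OF e(2) pe(1)] subsetD[OF e(2) pe(2)] e(1) pi_gt3 by auto
  have "indicator {p..p + e} (orientation (T j)) = (0::real)" for j
    by (rule indicator_simps(2)) (use sub e(2) in blast)
  then have "(\<lambda>n. (1 / real n) * (\<Sum>j<n. indicator {p..p + e} (orientation (T j)) :: real)) = (\<lambda>n. 0)"
    by (simp only: sum.neutral_const mult_zero_right)
  moreover have "(\<lambda>n. (1 / real n) * (\<Sum>j<n. indicator {p..p + e} (orientation (T j)) :: real))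
      \<longlonglongrightarrow> (p + e - p) / (2 * pi)"
    using assms range unfolding statistical_circular_symmetry_def by blast
  ultimately have "(\<lambda>n. 0 :: real) \<longlonglongrightarrow> e / (2 * pi)" by simp
  then have "e / (2 * pi) = 0" by (simp add: LIMSEQ_const_iff)
  then show False using e(1) by simp
qed

theorem theorem3p3:
  fixes P :: "'i::finite \<Rightarrow> complex set"
    and l :: real
    and \<sigma> :: "'i \<Rightarrow> 'i tile set"
    and T :: "nat \<Rightarrow> 'i tile"
    and x :: "'i \<Rightarrow> complex"
    and \<Lambda> :: "complex set"
    and \<mu> :: "complex measure"
  assumes "prototiles P"
    and "primitive_substitution_tiling P l \<sigma> (range T)"
    and "statistical_circular_symmetry P l \<sigma> T"
    and "\<And>i. x i \<in> P i"
    and "\<Lambda> = range (\<lambda>j. place (T j) (x (proto (T j))))"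
    and "diffraction \<Lambda> \<mu>"
  shows "circular_symmetric \<mu>"
proof -
  have prim: "primitive \<sigma>" and sub: "substitution P l \<sigma>" and tiling: "tiling P (range T)"
    using assms(2) by (auto simp: primitive_substitution_tiling_def substitution_tiling_def)
  then have tiles: "range T \<subseteq> tiles" and no: "non_overlapping P (range T)"
    by (auto simp: tiling_def)
  have num: "supertile_numbering l \<sigma> T"
    using assms(3) by (simp add: statistical_circular_symmetry_def)
  interpret self_similar_substitution P l \<sigma> x
    by unfold_locales (use assms(1,4) sub in auto)
  obtain \<gamma> where ac: "autocorrelation \<Lambda> \<gamma>" and four: "fourier_measure \<gamma> \<mu>"
    using assms(6) by (auto simp: diffraction_def)
  have rad: "radon_measure \<gamma>" using ac by (simp add: autocorrelation_def)
  have "no_angular_modes \<gamma>"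
    unfolding no_angular_modes_def
  proof (intro allI impI, elim conjE)
    fix m :: nat and F :: "complex \<Rightarrow> complex" and \<rho> :: real
    assume m: "m > 0" and F: "continuous_on UNIV F" and F_0: "\<forall>z. cmod z > \<rho> \<longrightarrow> F z = 0"
      and F_rot: "\<forall>u z. cmod u = 1 \<longrightarrow> F (u * z) = u ^ m * F z"
    have "bounded (F ` cball 0 \<rho>)"
      by (intro compact_imp_bounded compact_continuous_image continuous_on_subset[OF F]) auto
    then obtain C where C: "\<forall>z\<in>cball 0 \<rho>. cmod (F z) \<le> C" unfolding bounded_iff by blast
    have bound: "cmod (F z) \<le> max C 0" for z
    proof (cases "cmod z > \<rho>")
      case False
      then show ?thesis using C by (simp add: le_max_iff_disj)
    qed (use F_0 in simp)
    \<comment> \<open>Enlarging \<rho> to at least 1 supplies the positivity demanded by the locale;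
      \<open>max C 0\<close> also bounds the zero values outside the ball, even if \<rho> is
      negative and \<open>C\<close> is a bound on the empty set.\<close>
    interpret angular_mode P l \<sigma> x F "max \<rho> 1" "max C 0" m
      by unfold_locales (use F_0 F_rot bound in auto)
    have "\<exists>n j. \<exists>S\<in>super n j. \<exists>S'\<in>super n j. proto S = proto S' \<and> rot S ^ m \<noteq> rot S' ^ m"
      using finite_rotations[OF num tiles m] infinite_rotations[OF assms(3)] by blast
    then obtain N where "\<And>j. \<exists>S\<in>super N j. \<exists>S'\<in>super N j. proto S = proto S' \<and> rot S ^ m \<noteq> rot S' ^ m"
      using separation[OF prim] by metis
    then have t: "mode_ratio \<longlonglongrightarrow> 0" by (rule mode_ratio_tendsto)
    have \<Lambda>: "\<Lambda> = points (range T)"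
      by (auto simp: assms(5) points_def point_def)
    show "(\<integral>z. F z \<partial>\<gamma>) = 0"
    proof (rule autocorrelation_integral_eq_0[OF ac _ F])
      show "finite (\<Lambda> \<inter> cball 0 r)" for r
      proof -
        have "\<Lambda> \<inter> cball 0 r = point ` {S \<in> range T. point S \<in> cball 0 r}"
          unfolding \<Lambda> points_def by blast
        then show ?thesis using card_points_near(1)[OF tiles no, of 0 r] by simp
      qed
      show "((\<lambda>r. pair_sum F (\<Lambda> \<inter> cball 0 r) / complex_of_real (measure lborel (cball 0 r :: complex set))) \<longlongrightarrow> 0) at_top"
        unfolding \<Lambda> by (rule pair_sum_ball_tendsto[OF tiles no numbering_cover[OF num] t])
      show "integrable \<gamma> F"
        by (rule radon_measure_integrable[OF rad F compact_cball[of 0 \<rho>]]) (use F_0 in auto)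
      show "\<And>z. cmod z > \<rho> \<Longrightarrow> F z = 0" using F_0 by blast
    qed
  qed
  then show ?thesis
    using no_angular_modes_rotated[OF rad] fourier_measure_circular_symmetric[OF _ four] by blast
qed

end
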